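(* Let $\Omega\subset\mathbb C^n$ be a domain and $f$ a smooth real function on $\Omega$ with $(f_{i\bar j})>0$. Let $\alpha,\kappa$ be constants and set $W=\det(f_{s\bar t})$, $V=\log W$, $\Psi=\|\nabla V\|_f^2$, $P=\exp(\kappa W^\alpha)\sqrt W\,\Psi$. Then, at every point where $\Psi\ne0$, $$\frac{\square P}{P}\ge\frac{\|V_{,i\bar j}\|_f^2}{2\Psi}+\alpha^2\kappa(1-2\kappa W^\alpha)W^\alpha\Psi-\frac{2|\langle\nabla\mathcal S,\nabla V\rangle|}{\Psi}-\Big(\alpha\kappa W^\alpha+\tfrac12\Big)\mathcal S,$$ where $\langle\cdot,\cdot\rangle$ denotes the inner product with respect to the metric $\omega_f$.
   Context: $f_{i\bar j}=\partial^2f/\partial z_i\partial\bar z_j$ is the Kähler metric $\omega_f$, $(f^{i\bar j})$ its inverse; $\square=\sum f^{i\bar j}\partial^2/\partial z_i\partial\bar z_j$; $\mathcal S=\mathcal S(f)=-\square V$; $\|\nabla V\|_f^2=\sum f^{i\bar j}V_iV_{\bar j}$; $\langle\nabla\mathcal S,\nabla V\rangle=\sum f^{i\bar j}V_i\mathcal S_{\bar j}$; $\|V_{,i\bar j}\|_f^2=\sum f^{i\bar j}f^{k\bar l}V_{i\bar l}V_{k\bar j}$. *)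

theory Defs
  imports "HOL-Analysis.Analysis"
begin

primrec Ck_on :: "nat \<Rightarrow> ('a::real_normed_vector \<Rightarrow> 'b::real_normed_vector) \<Rightarrow> 'a set \<Rightarrow> bool" where
  "Ck_on 0 g X \<longleftrightarrow> continuous_on X g"
| "Ck_on (Suc k) g X \<longleftrightarrow>
     (\<forall>x\<in>X. g differentiable at x) \<and> (\<forall>v. Ck_on k (\<lambda>x. frechet_derivative g (at x) v) X)"

definition smooth_on :: "('a::real_normed_vector \<Rightarrow> 'b::real_normed_vector) \<Rightarrow> 'a set \<Rightarrow> bool" where
  "smooth_on g X \<longleftrightarrow> (\<forall>k. Ck_on k g X)"

definition domain_set :: "'a::topological_space set \<Rightarrow> bool" where
  "domain_set X \<longleftrightarrow> open X \<and> connected X \<and> X \<noteq> {}"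

(* With z_i = x_i + \<i> y_i, the directions axis i 1 and axis i \<i> give d/dx_i and d/dy_i. *)
definition d_z :: "'n::finite \<Rightarrow> (complex^'n \<Rightarrow> complex) \<Rightarrow> complex^'n \<Rightarrow> complex" where
  "d_z i g z = (frechet_derivative g (at z) (axis i 1)
                - \<i> * frechet_derivative g (at z) (axis i \<i>)) / 2"

definition d_zbar :: "'n::finite \<Rightarrow> (complex^'n \<Rightarrow> complex) \<Rightarrow> complex^'n \<Rightarrow> complex" where
  "d_zbar i g z = (frechet_derivative g (at z) (axis i 1)
                   + \<i> * frechet_derivative g (at z) (axis i \<i>)) / 2"

definition real_to_complex_fun :: "('a \<Rightarrow> real) \<Rightarrow> 'a \<Rightarrow> complex" where
  "real_to_complex_fun u = (\<lambda>z. complex_of_real (u z))"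

(* Row index i is the holomorphic one, column index j the antiholomorphic one. *)
definition complex_hessian :: "(complex^'n::finite \<Rightarrow> real) \<Rightarrow> complex^'n \<Rightarrow> complex^'n^'n" where
  "complex_hessian u z = (\<chi> i j. d_z i (d_zbar j (real_to_complex_fun u)) z)"

definition pos_def_hermitian :: "complex^'n^'n::finite \<Rightarrow> bool" where
  "pos_def_hermitian A \<longleftrightarrow>
     (\<forall>i j. A $ j $ i = cnj (A $ i $ j)) \<and>
     (\<forall>v. v \<noteq> 0 \<longrightarrow> 0 < Re (\<Sum>i\<in>UNIV. \<Sum>j\<in>UNIV. A $ i $ j * v $ i * cnj (v $ j)))"

(* f^(i jbar) is normalised by sum_j f^(i jbar) f_(k jbar) = delta_ik, hence the transpose. *)
definition inverse_metric :: "(complex^'n::finite \<Rightarrow> real) \<Rightarrow> complex^'n \<Rightarrow> complex^'n^'n" where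
  "inverse_metric f z = transpose (matrix_inv (complex_hessian f z))"

(* In the definitions below Re only changes the type from complex to real: where the metric is
   positive definite and the functions involved are smooth and real, the complex Hessians are
   Hermitian, so the sums and the determinant are real. *)

definition square_op ::
    "(complex^'n::finite \<Rightarrow> real) \<Rightarrow> (complex^'n \<Rightarrow> real) \<Rightarrow> complex^'n \<Rightarrow> real" where
  "square_op f u z =
     Re (\<Sum>i\<in>UNIV. \<Sum>j\<in>UNIV. inverse_metric f z $ i $ j * complex_hessian u z $ i $ j)"

(* The pairing <grad u, grad v> = sum f^(i jbar) v_i u_jbar; complex-valued in general. *)
definition grad_inner ::
    "(complex^'n::finite \<Rightarrow> real) \<Rightarrow> (complex^'n \<Rightarrow> real) \<Rightarrow> (complex^'n \<Rightarrow> real) \<Rightarrow> complex^'n \<Rightarrow> complex" where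
  "grad_inner f u v z =
     (\<Sum>i\<in>UNIV. \<Sum>j\<in>UNIV. inverse_metric f z $ i $ j
        * d_z i (real_to_complex_fun v) z * d_zbar j (real_to_complex_fun u) z)"

definition grad_norm_sq ::
    "(complex^'n::finite \<Rightarrow> real) \<Rightarrow> (complex^'n \<Rightarrow> real) \<Rightarrow> complex^'n \<Rightarrow> real" where
  "grad_norm_sq f u z = Re (grad_inner f u u z)"

definition mixed_hessian_norm_sq ::
    "(complex^'n::finite \<Rightarrow> real) \<Rightarrow> (complex^'n \<Rightarrow> real) \<Rightarrow> complex^'n \<Rightarrow> real" where
  "mixed_hessian_norm_sq f u z =
     Re (\<Sum>i\<in>UNIV. \<Sum>j\<in>UNIV. \<Sum>k\<in>UNIV. \<Sum>l\<in>UNIV.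
           inverse_metric f z $ i $ j * inverse_metric f z $ k $ l
           * complex_hessian u z $ i $ l * complex_hessian u z $ k $ j)"

definition det_metric :: "(complex^'n::finite \<Rightarrow> real) \<Rightarrow> complex^'n \<Rightarrow> real" where
  "det_metric f z = Re (det (complex_hessian f z))"

definition log_det_metric :: "(complex^'n::finite \<Rightarrow> real) \<Rightarrow> complex^'n \<Rightarrow> real" where
  "log_det_metric f z = ln (det_metric f z)"

definition scal_curv :: "(complex^'n::finite \<Rightarrow> real) \<Rightarrow> complex^'n \<Rightarrow> real" where
  "scal_curv f z = - square_op f (log_det_metric f) z"

definition Psi :: "(complex^'n::finite \<Rightarrow> real) \<Rightarrow> complex^'n \<Rightarrow> real" where
  "Psi f z = grad_norm_sq f (log_det_metric f) z"

definition P_fun :: "real \<Rightarrow> real \<Rightarrow> (complex^'n::finite \<Rightarrow> real) \<Rightarrow> complex^'n \<Rightarrow> real" where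
  "P_fun \<alpha> \<kappa> f z =
     exp (\<kappa> * det_metric f z powr \<alpha>) * sqrt (det_metric f z) * Psi f z"

end

theory Submission
  imports Defs "HOL-Complex_Analysis.Complex_Analysis"
begin

text \<open>
  Write \<open>P = exp (h(V)) \<Psi>\<close> with \<open>h(V) = \<kappa> exp(\<alpha>V) + V/2\<close>. The product rule expresses \<open>\<box>P / P\<close> through
  \<open>h'\<close>, \<open>h''\<close>, \<open>\<box>V\<close>, \<open>\<langle>\<nabla>V, \<nabla>\<Psi>\<rangle>\<close> and \<open>\<box>\<Psi>\<close>. Let \<open>T\<close> be the covariant \<open>(2,0)\<close>-Hessian of \<open>V\<close> and
  \<open>U\<close> its complex Hessian. As \<open>- U\<close> is the Ricci form of the metric, the Bochner formula reads
  \<open>\<box>\<Psi> = \<parallel>T\<parallel>\<^sup>2 + \<parallel>U\<parallel>\<^sup>2 - 2 Re \<langle>\<nabla>S, \<nabla>V\<rangle> - U(\<nabla>V, \<nabla>V)\<close>. The claim follows by completing two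
  squares: \<open>\<parallel>T + h' \<partial>V \<otimes> \<partial>V\<parallel>\<^sup>2 \<ge> 0\<close> and \<open>\<parallel>U + 2\<alpha>\<kappa>W\<^sup>\<alpha> \<partial>V \<otimes> cnj \<partial>V\<parallel>\<^sup>2 \<ge> 0\<close>.
\<close>

subsection \<open>Smooth functions\<close>

text \<open>No curvature tensor and no normal coordinates occur. Curvature enters only because
  \<open>V\<close> is itself the logarithm of the determinant of the metric: differentiating
  Jacobi's formula for \<open>V\<close> once more expresses its complex Hessian through third and
  fourth derivatives of \<open>f\<close>, and exactly these terms are left over when the Laplacian
  of \<open>Psi\<close> is expanded in the given coordinates. The factor \<open>sqrt W\<close> in
  \<open>P\<close> is tuned to the Bochner formula. It adds 1/2 to the derivative of the weight
  exponent, and in the cross term between \<open>V\<close> and \<open>Psi\<close> this 1/2 produces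
  the very expression that cancels the Ricci term. What is left of that expression has the
  coefficient 2a with a = \<alpha> \<kappa> W^\<alpha>. Half of the second square absorbs it, at the
  price of half the norm of the mixed Hessian and of 2 a^2 Psi^2; this is the origin of the
  denominator 2 Psi and of the factor 1 - 2 \<kappa> W^\<alpha>. Wirtinger derivatives act on
  complex-valued functions, so every real quantity is carried as a complex function that is shown to
  be real on the open set.\<close>

lemma Ck_on_cong:
  assumes "open X" "Ck_on k g X" "\<And>x. x \<in> X \<Longrightarrow> g x = h x"
  shows "Ck_on k h X"
  using assms(2,3)
proof (induction k arbitrary: g h)
  case 0
  then show ?case
    by (metis Ck_on.simps(1) continuous_on_cong)
next
  case (Suc k)
  have h: "h differentiable at x" if "x \<in> X" for x
    using Suc.prems that assms(1) has_derivative_transform_within_open unfolding differentiable_def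
    by (metis Ck_on.simps(2) differentiable_def)
  have eq: "frechet_derivative g (at x) = frechet_derivative h (at x)" if "x \<in> X" for x
    using Suc.prems that assms(1) by (intro frechet_derivative_transform_within_open) auto
  show ?case
    using h Suc.IH[OF _ eq[THEN fun_cong]] Suc.prems(1) by auto
qed

lemma Ck_on_SucD: "Ck_on (Suc k) g X \<Longrightarrow> Ck_on k g X"
proof (induction k arbitrary: g)
  case 0
  then show ?case
    by (auto intro!: continuous_at_imp_continuous_on differentiable_imp_continuous_within)
next
  case (Suc k)
  then show ?case by (metis Ck_on.simps(2))
qed

text \<open>Closure proofs can supply an explicit derivative \<open>g'\<close>: derivatives are
  unique, and on an open set \<open>Ck_on_cong\<close> passes from \<open>g'\<close> to
  \<open>frechet_derivative\<close>.\<close>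

lemma Ck_on_SucI:
  assumes "open X"
    and der: "\<And>x. x \<in> X \<Longrightarrow> (g has_derivative g' x) (at x)"
    and Ck: "\<And>v. Ck_on k (\<lambda>x. g' x v) X"
  shows "Ck_on (Suc k) g X"
  using assms Ck_on_cong[OF assms(1) Ck] frechet_derivative_at[OF der]
  by (auto simp: differentiable_def)

lemma Ck_on_has_derivative:
  assumes "Ck_on (Suc k) g X" "x \<in> X"
  shows "(g has_derivative frechet_derivative g (at x)) (at x)"
  using assms frechet_derivative_works by auto

lemma Ck_on_const: "open X \<Longrightarrow> Ck_on k (\<lambda>x. c) X"
proof (induction k arbitrary: c)
  case (Suc k)
  then show ?case by (intro Ck_on_SucI[where g' = "\<lambda>_ _. 0"]) auto
qed simp

lemma Ck_on_bounded_linear: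
  assumes "bounded_linear L" "open X"
  shows "Ck_on k g X \<Longrightarrow> Ck_on k (\<lambda>x. L (g x)) X"
proof (induction k arbitrary: g)
  case 0
  then show ?case
    by (simp add: bounded_linear.continuous_on[OF assms(1)])
next
  case (Suc k)
  show ?case
    using bounded_linear.has_derivative[OF assms(1) Ck_on_has_derivative[OF Suc.prems]] Suc assms(2)
    by (intro Ck_on_SucI[where g' = "\<lambda>x v. L (frechet_derivative g (at x) v)"]) auto
qed

lemma Ck_on_add:
  assumes "open X"
  shows "Ck_on k g X \<Longrightarrow> Ck_on k h X \<Longrightarrow> Ck_on k (\<lambda>x. g x + h x) X"
proof (induction k arbitrary: g h)
  case 0
  then show ?case by (auto intro: continuous_intros)
next
  case (Suc k)
  show ?case
    using has_derivative_add[OF Ck_on_has_derivative[OF Suc.prems(1)] Ck_on_has_derivative[OF Suc.prems(2)]]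
      Suc assms
    by (intro Ck_on_SucI[where g' = "\<lambda>x v. frechet_derivative g (at x) v + frechet_derivative h (at x) v"])
      auto
qed

lemma Ck_on_mult:
  fixes g h :: "'a::real_normed_vector \<Rightarrow> 'b::real_normed_algebra"
  assumes "open X"
  shows "Ck_on k g X \<Longrightarrow> Ck_on k h X \<Longrightarrow> Ck_on k (\<lambda>x. g x * h x) X"
proof (induction k arbitrary: g h)
  case 0
  then show ?case by (auto intro: continuous_intros)
next
  case (Suc k)
  \<comment> \<open>The product rule also contains \<open>g\<close> and \<open>h\<close>
    undifferentiated, so the induction hypothesis needs them at order \<open>k\<close>.\<close>
  have "Ck_on k g X" "Ck_on k h X"
    using Suc.prems Ck_on_SucD by blast+
  then show ?case
    using has_derivative_mult[OF Ck_on_has_derivative[OF Suc.prems(1)] Ck_on_has_derivative[OF Suc.prems(2)]]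
      Suc assms
    by (intro Ck_on_SucI[where g' = "\<lambda>x v. g x * frechet_derivative h (at x) v + frechet_derivative g (at x) v * h x"])
      (auto intro!: Ck_on_add)
qed

text \<open>The chain rule yields \<open>deriv \<phi>\<close> composed with \<open>u\<close>, and
  \<open>deriv \<phi>\<close> is again holomorphic; hence the induction runs with
  \<open>\<phi>\<close> arbitrary. One rule thus serves \<open>inverse\<close>, \<open>exp\<close>
  and \<open>Ln\<close>.\<close>

lemma Ck_on_holomorphic_compose:
  fixes u :: "'a::real_normed_vector \<Rightarrow> complex"
  assumes "open X" "open Y"
  shows "Ck_on k u X \<Longrightarrow> \<phi> holomorphic_on Y \<Longrightarrow> u ` X \<subseteq> Y \<Longrightarrow> Ck_on k (\<lambda>x. \<phi> (u x)) X"
proof (induction k arbitrary: \<phi>)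
  case 0
  then show ?case
    by (auto intro: continuous_on_compose2 holomorphic_on_imp_continuous_on)
next
  case (Suc k)
  have "(\<phi> has_field_derivative deriv \<phi> (u x)) (at (u x))" if "x \<in> X" for x
    using that Suc.prems assms(2) by (auto intro: holomorphic_derivI)
  then have der: "((\<lambda>x. \<phi> (u x)) has_derivative
      (\<lambda>v. deriv \<phi> (u x) * frechet_derivative u (at x) v)) (at x)" if "x \<in> X" for x
    using that has_derivative_compose[OF Ck_on_has_derivative[OF Suc.prems(1) that]]
    unfolding has_field_derivative_def by blast
  have "Ck_on k (\<lambda>x. deriv \<phi> (u x)) X"
    using Suc.IH[OF Ck_on_SucD[OF Suc.prems(1)] holomorphic_deriv] Suc.prems assms(2) by blast
  then show ?case
    using Suc.prems assms der by (intro Ck_on_SucI[OF assms(1) der]) (auto intro!: Ck_on_mult)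
qed

lemma smooth_on_differentiable: "smooth_on g X \<Longrightarrow> x \<in> X \<Longrightarrow> g differentiable at x"
  unfolding smooth_on_def by (metis Ck_on.simps(2))

lemma smooth_on_frechet: "smooth_on g X \<Longrightarrow> smooth_on (\<lambda>x. frechet_derivative g (at x) v) X"
  unfolding smooth_on_def by (metis Ck_on.simps(2))

lemma smooth_on_cong:
  "open X \<Longrightarrow> smooth_on g X \<Longrightarrow> (\<And>x. x \<in> X \<Longrightarrow> g x = h x) \<Longrightarrow> smooth_on h X"
  unfolding smooth_on_def using Ck_on_cong by blast

lemma smooth_on_const: "open X \<Longrightarrow> smooth_on (\<lambda>x. c) X"
  by (simp add: smooth_on_def Ck_on_const)

lemma smooth_on_bounded_linear:
  "bounded_linear L \<Longrightarrow> open X \<Longrightarrow> smooth_on g X \<Longrightarrow> smooth_on (\<lambda>x. L (g x)) X"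
  by (simp add: smooth_on_def Ck_on_bounded_linear)

lemma smooth_on_add: "open X \<Longrightarrow> smooth_on g X \<Longrightarrow> smooth_on h X \<Longrightarrow> smooth_on (\<lambda>x. g x + h x) X"
  by (simp add: smooth_on_def Ck_on_add)

lemma smooth_on_minus: "open X \<Longrightarrow> smooth_on g X \<Longrightarrow> smooth_on (\<lambda>x. - g x) X"
  by (rule smooth_on_bounded_linear[OF bounded_linear_minus[OF bounded_linear_ident]])

lemma smooth_on_diff: "open X \<Longrightarrow> smooth_on g X \<Longrightarrow> smooth_on h X \<Longrightarrow> smooth_on (\<lambda>x. g x - h x) X"
  using smooth_on_add[of X g "\<lambda>x. - h x"] smooth_on_minus[of X h] by simp

lemma smooth_on_mult:
  fixes g h :: "'a::real_normed_vector \<Rightarrow> 'b::real_normed_algebra"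
  shows "open X \<Longrightarrow> smooth_on g X \<Longrightarrow> smooth_on h X \<Longrightarrow> smooth_on (\<lambda>x. g x * h x) X"
  by (simp add: smooth_on_def Ck_on_mult)

lemma smooth_on_sum:
  assumes "open X" "\<And>i. i \<in> I \<Longrightarrow> smooth_on (g i) X"
  shows "smooth_on (\<lambda>x. \<Sum>i\<in>I. g i x) X"
  using assms(2)
  by (induction I rule: infinite_finite_induct)
    (auto intro!: smooth_on_add smooth_on_const assms(1))

lemma smooth_on_prod:
  fixes g :: "'i \<Rightarrow> 'a::real_normed_vector \<Rightarrow> 'b::real_normed_field"
  assumes "open X" "\<And>i. i \<in> I \<Longrightarrow> smooth_on (g i) X"
  shows "smooth_on (\<lambda>x. \<Prod>i\<in>I. g i x) X"
  using assms(2)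
  by (induction I rule: infinite_finite_induct)
    (auto intro!: smooth_on_mult smooth_on_const assms(1))

lemma smooth_on_holomorphic_compose:
  fixes u :: "'a::real_normed_vector \<Rightarrow> complex"
  shows "open X \<Longrightarrow> open Y \<Longrightarrow> smooth_on u X \<Longrightarrow> \<phi> holomorphic_on Y \<Longrightarrow> u ` X \<subseteq> Y
    \<Longrightarrow> smooth_on (\<lambda>x. \<phi> (u x)) X"
  by (simp add: smooth_on_def Ck_on_holomorphic_compose)

lemma smooth_on_det:
  fixes M :: "'a::real_normed_vector \<Rightarrow> complex^'n^'n"
  assumes "open X" "\<And>i j. smooth_on (\<lambda>x. M x $ i $ j) X"
  shows "smooth_on (\<lambda>x. det (M x)) X"
  unfolding det_def by (intro smooth_on_sum smooth_on_mult smooth_on_prod smooth_on_const assms)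

lemma smooth_on_inverse:
  fixes u :: "'a::real_normed_vector \<Rightarrow> complex"
  assumes "open X" "smooth_on u X" "\<And>x. x \<in> X \<Longrightarrow> u x \<noteq> 0"
  shows "smooth_on (\<lambda>x. inverse (u x)) X"
  using assms
  by (intro smooth_on_holomorphic_compose[where Y = "- {0}" and \<phi> = inverse])
    (auto intro!: holomorphic_intros)

lemma smooth_on_exp:
  fixes u :: "'a::real_normed_vector \<Rightarrow> complex"
  assumes "open X" "smooth_on u X"
  shows "smooth_on (\<lambda>x. exp (u x)) X"
  using assms
  by (intro smooth_on_holomorphic_compose[where Y = UNIV and \<phi> = exp]) (auto intro!: holomorphic_intros)

subsection \<open>Symmetry of second derivatives\<close>

text \<open>Both iterated derivatives are limits of the same second difference quotient.\<close>

lemma second_difference_mean_value: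
  fixes g :: "'a::real_normed_vector \<Rightarrow> real"
  assumes "0 < h" "\<And>s t. 0 \<le> s \<Longrightarrow> s \<le> h \<Longrightarrow> 0 \<le> t \<Longrightarrow> t \<le> h \<Longrightarrow> z + s *\<^sub>R v + t *\<^sub>R w \<in> X"
    and "Ck_on 2 g X"
  shows "\<exists>s t. 0 < s \<and> s < h \<and> 0 < t \<and> t < h \<and>
    g (z + h *\<^sub>R v + h *\<^sub>R w) - g (z + h *\<^sub>R v) - g (z + h *\<^sub>R w) + g z =
      h * h * frechet_derivative (\<lambda>x. frechet_derivative g (at x) v) (at (z + s *\<^sub>R v + t *\<^sub>R w)) w"
proof -
  define gv where "gv x = frechet_derivative g (at x) v" for x
  have g: "(g has_derivative frechet_derivative g (at x)) (at x)" if "x \<in> X" for x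
    using assms(3) that frechet_derivative_works by (auto simp: numeral_2_eq_2)
  have gv: "(gv has_derivative frechet_derivative gv (at x)) (at x)" if "x \<in> X" for x
    using assms(3) that unfolding gv_def by (auto simp: numeral_2_eq_2 simp flip: frechet_derivative_works)
  have lin: "frechet_derivative g (at x) (c *\<^sub>R y) = c * frechet_derivative g (at x) y" if "x \<in> X" for x c y
    using linear_scale[OF has_derivative_linear[OF g[OF that]]] by simp
  have linv: "frechet_derivative gv (at x) (c *\<^sub>R y) = c * frechet_derivative gv (at x) y" if "x \<in> X" for x c y
    using linear_scale[OF has_derivative_linear[OF gv[OF that]]] by simp
  \<comment> \<open>The second difference is \<open>G h - G 0\<close>. The mean value theorem in
    \<open>s\<close> turns it into a first difference of \<open>gv\<close> along \<open>w\<close>,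
    and a second use in \<open>t\<close> gives the iterated derivative.\<close>
  define G where "G s = g (z + s *\<^sub>R v + h *\<^sub>R w) - g (z + s *\<^sub>R v)" for s
  have 1: "((\<lambda>s. g (z + s *\<^sub>R v + t *\<^sub>R w)) has_real_derivative gv (z + s *\<^sub>R v + t *\<^sub>R w)) (at s)"
    if "0 \<le> s" "s \<le> h" "0 \<le> t" "t \<le> h" for s t
  proof -
    have "((\<lambda>s. z + s *\<^sub>R v + t *\<^sub>R w) has_derivative (\<lambda>c. c *\<^sub>R v)) (at s)"
      by (auto intro!: derivative_eq_intros)
    from has_derivative_compose[OF this g[OF assms(2)[OF that]]] show ?thesis
      using assms(2)[OF that] by (simp add: has_field_derivative_def lin gv_def mult.commute[of _ "frechet_derivative _ _ _"])
  qed
  have 2: "((\<lambda>t. gv (z + s *\<^sub>R v + t *\<^sub>R w)) has_real_derivative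
      frechet_derivative gv (at (z + s *\<^sub>R v + t *\<^sub>R w)) w) (at t)"
    if "0 \<le> s" "s \<le> h" "0 \<le> t" "t \<le> h" for s t
  proof -
    have "((\<lambda>t. z + s *\<^sub>R v + t *\<^sub>R w) has_derivative (\<lambda>c. c *\<^sub>R w)) (at t)"
      by (auto intro!: derivative_eq_intros)
    from has_derivative_compose[OF this gv[OF assms(2)[OF that]]] show ?thesis
      using assms(2)[OF that] by (simp add: has_field_derivative_def linv mult.commute[of _ "frechet_derivative _ _ _"])
  qed
  have "\<exists>s. 0 < s \<and> s < h \<and> G h - G 0 = (h - 0) * (gv (z + s *\<^sub>R v + h *\<^sub>R w) - gv (z + s *\<^sub>R v))"
    unfolding G_def using assms(1) 1[of _ h] 1[of _ 0]
    by (intro MVT2) (auto intro!: DERIV_diff)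
  then obtain s where s: "0 < s" "s < h" "G h - G 0 = h * (gv (z + s *\<^sub>R v + h *\<^sub>R w) - gv (z + s *\<^sub>R v))"
    by auto
  have "\<exists>t. 0 < t \<and> t < h \<and> gv (z + s *\<^sub>R v + h *\<^sub>R w) - gv (z + s *\<^sub>R v + 0 *\<^sub>R w)
      = (h - 0) * frechet_derivative gv (at (z + s *\<^sub>R v + t *\<^sub>R w)) w"
    using assms(1) 2[of s] s by (intro MVT2) auto
  then obtain t where t: "0 < t" "t < h" "gv (z + s *\<^sub>R v + h *\<^sub>R w) - gv (z + s *\<^sub>R v)
      = h * frechet_derivative gv (at (z + s *\<^sub>R v + t *\<^sub>R w)) w"
    by auto
  have "g (z + h *\<^sub>R v + h *\<^sub>R w) - g (z + h *\<^sub>R v) - g (z + h *\<^sub>R w) + g z = G h - G 0"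
    by (simp add: G_def)
  then show ?thesis
    using s t unfolding gv_def by (intro exI[of _ s] exI[of _ t]) simp
qed

lemma frechet_derivative_commute_real:
  fixes g :: "'a::real_normed_vector \<Rightarrow> real"
  assumes "open X" "z \<in> X" "Ck_on 2 g X"
  shows "frechet_derivative (\<lambda>x. frechet_derivative g (at x) v) (at z) w =
    frechet_derivative (\<lambda>x. frechet_derivative g (at x) w) (at z) v" (is "?A z = ?B z")
proof (rule ccontr)
  assume ne: "?A z \<noteq> ?B z"
  \<comment> \<open>Half the gap: two equal numbers cannot lie within \<open>e\<close> of the two
    different values.\<close>
  define e where "e = \<bar>?A z - ?B z\<bar> / 2"
  have e: "e > 0" using ne by (simp add: e_def)
  have cA: "continuous_on X ?A" and cB: "continuous_on X ?B"
    using assms(3) by (auto simp: numeral_2_eq_2)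
  obtain d where d: "d > 0" "ball z d \<subseteq> X" using assms open_contains_ball by blast
  obtain d1 where d1: "d1 > 0" "\<And>x. x \<in> X \<Longrightarrow> dist x z < d1 \<Longrightarrow> dist (?A x) (?A z) < e"
    using cA e assms(2) unfolding continuous_on_iff by metis
  obtain d2 where d2: "d2 > 0" "\<And>x. x \<in> X \<Longrightarrow> dist x z < d2 \<Longrightarrow> dist (?B x) (?B z) < e"
    using cB e assms(2) unfolding continuous_on_iff by metis
  define r where "r = min d (min d1 d2)"
  \<comment> \<open>The summand 1 keeps \<open>c\<close> positive when both directions vanish. With
    \<open>h = r / (2 * c)\<close> the whole parallelogram stays within \<open>r / 2\<close> of
    \<open>z\<close>.\<close>
  define c where "c = norm v + norm w + 1"
  define h where "h = r / (2 * c)"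
  have r: "r > 0" using d d1 d2 by (simp add: r_def)
  have nz: "c > 0"
    unfolding c_def by (smt (verit) norm_ge_zero)
  have h: "h > 0" using r nz by (simp add: h_def)
  have close: "dist (z + s *\<^sub>R v + t *\<^sub>R w) z < r" if "0 \<le> s" "s \<le> h" "0 \<le> t" "t \<le> h" for s t
  proof -
    have "dist (z + s *\<^sub>R v + t *\<^sub>R w) z = norm (s *\<^sub>R v + t *\<^sub>R w)" by (simp add: dist_norm)
    also have "\<dots> \<le> s * norm v + t * norm w" using that norm_triangle_ineq[of "s *\<^sub>R v" "t *\<^sub>R w"] by simp
    also have "\<dots> \<le> h * norm v + h * norm w" using that by (intro add_mono mult_right_mono) auto
    also have "\<dots> \<le> h * c" using h by (simp add: c_def algebra_simps)
    also have "\<dots> = r / 2" using nz by (simp add: h_def)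
    finally show ?thesis using r by simp
  qed
  have inX: "z + s *\<^sub>R v + t *\<^sub>R w \<in> X" if "0 \<le> s" "s \<le> h" "0 \<le> t" "t \<le> h" for s t
    using close[OF that] d(2) by (auto simp: r_def dist_commute subset_iff)
  obtain s t where 1: "0 < s" "s < h" "0 < t" "t < h" 
    "g (z + h *\<^sub>R v + h *\<^sub>R w) - g (z + h *\<^sub>R v) - g (z + h *\<^sub>R w) + g z = h * h * ?A (z + s *\<^sub>R v + t *\<^sub>R w)"
    using second_difference_mean_value[OF h inX assms(3)] by auto
  have inX': "z + t *\<^sub>R w + s *\<^sub>R v \<in> X" if "0 \<le> s" "s \<le> h" "0 \<le> t" "t \<le> h" for s t
    using inX[OF that] by (simp add: algebra_simps)
  obtain s' t' where 2: "0 < s'" "s' < h" "0 < t'" "t' < h" 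
    "g (z + h *\<^sub>R w + h *\<^sub>R v) - g (z + h *\<^sub>R w) - g (z + h *\<^sub>R v) + g z = h * h * ?B (z + s' *\<^sub>R w + t' *\<^sub>R v)"
    using second_difference_mean_value[OF h inX' assms(3)] by auto
  have sw: "z + s' *\<^sub>R w + t' *\<^sub>R v = z + t' *\<^sub>R v + s' *\<^sub>R w" "z + h *\<^sub>R w + h *\<^sub>R v = z + h *\<^sub>R v + h *\<^sub>R w"
    by simp_all
  \<comment> \<open>The second difference is symmetric in \<open>v\<close> and \<open>w\<close>, so
    the two mean values agree although they are attained at different points of the
    parallelogram.\<close>
  have "h * h * ?A (z + s *\<^sub>R v + t *\<^sub>R w) = h * h * ?B (z + t' *\<^sub>R v + s' *\<^sub>R w)"
    using 1(5) 2(5) unfolding sw by linarith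
  then have "?A (z + s *\<^sub>R v + t *\<^sub>R w) = ?B (z + t' *\<^sub>R v + s' *\<^sub>R w)"
    using h by simp
  moreover have "dist (?A (z + s *\<^sub>R v + t *\<^sub>R w)) (?A z) < e"
    using close[of s t] inX[of s t] 1 by (intro d1(2)) (auto simp: r_def)
  moreover have "dist (?B (z + t' *\<^sub>R v + s' *\<^sub>R w)) (?B z) < e"
    using close[of t' s'] inX[of t' s'] 2 by (intro d2(2)) (auto simp: r_def)
  ultimately show False
    unfolding e_def dist_real_def by (smt (verit) field_sum_of_halves)
qed

lemma frechet_derivative_bounded_linear:
  assumes "bounded_linear L" "g differentiable at x"
  shows "frechet_derivative (\<lambda>x. L (g x)) (at x) v = L (frechet_derivative g (at x) v)"
  using frechet_derivative_at[OF bounded_linear.has_derivative[OF assms(1)]] assms(2)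
    frechet_derivative_works by metis

text \<open>The real case applied to each coordinate, since pairing with a basis vector commutes
  with differentiation.\<close>

lemma frechet_derivative_commute:
  fixes g :: "'a::real_normed_vector \<Rightarrow> 'b::euclidean_space"
  assumes "open X" "z \<in> X" "smooth_on g X"
  shows "frechet_derivative (\<lambda>x. frechet_derivative g (at x) v) (at z) w =
    frechet_derivative (\<lambda>x. frechet_derivative g (at x) w) (at z) v"
proof (rule euclidean_eqI)
  fix b :: 'b
  have bl: "bounded_linear (\<lambda>y. y \<bullet> b)" by (rule bounded_linear_inner_left)
  have sm: "smooth_on (\<lambda>x. g x \<bullet> b) X"
    by (rule smooth_on_bounded_linear[OF bl assms(1,3)])
  have *: "frechet_derivative (\<lambda>x. frechet_derivative (\<lambda>y. g y \<bullet> b) (at x) v) (at z) w =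
      frechet_derivative (\<lambda>x. frechet_derivative g (at x) v) (at z) w \<bullet> b" for v w
  proof -
    have "frechet_derivative (\<lambda>x. frechet_derivative (\<lambda>y. g y \<bullet> b) (at x) v) (at z) =
      frechet_derivative (\<lambda>x. frechet_derivative g (at x) v \<bullet> b) (at z)"
      using assms sm smooth_on_differentiable[OF smooth_on_frechet[OF sm]]
      by (intro frechet_derivative_transform_within_open[of _ _ X])
        (auto intro!: frechet_derivative_bounded_linear[OF bl] smooth_on_differentiable)
    then show ?thesis
      using frechet_derivative_bounded_linear[OF bl smooth_on_differentiable[OF smooth_on_frechet[OF assms(3)] assms(2)]]
      by simp
  qed
  show "frechet_derivative (\<lambda>x. frechet_derivative g (at x) v) (at z) w \<bullet> b =
    frechet_derivative (\<lambda>x. frechet_derivative g (at x) w) (at z) v \<bullet> b"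
    using frechet_derivative_commute_real[OF assms(1,2), of "\<lambda>x. g x \<bullet> b" v w] sm
    by (simp add: * smooth_on_def)
qed

subsection \<open>Wirtinger derivatives\<close>

text \<open>The parameter \<open>c\<close> is \<i> for the holomorphic and -\<i> for the
  antiholomorphic derivative, so each rule is proved once for both.\<close>

definition wirtinger :: "complex \<Rightarrow> 'n::finite \<Rightarrow> (complex^'n \<Rightarrow> complex) \<Rightarrow> complex^'n \<Rightarrow> complex" where
  "wirtinger c i g z = (frechet_derivative g (at z) (axis i 1)
                        - c * frechet_derivative g (at z) (axis i \<i>)) / 2"

lemma d_z_eq_wirtinger: "d_z i = wirtinger \<i> i"
  and d_zbar_eq_wirtinger: "d_zbar i = wirtinger (- \<i>) i"
  by (auto simp: fun_eq_iff d_z_def d_zbar_def wirtinger_def)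

lemma wirtinger_has_derivative:
  "(g has_derivative g') (at z) \<Longrightarrow> wirtinger c i g z = (g' (axis i 1) - c * g' (axis i \<i>)) / 2"
  by (simp add: wirtinger_def frechet_derivative_at[symmetric])

lemma wirtinger_const: "wirtinger c i (\<lambda>x. a) z = 0"
  by (simp add: wirtinger_def)

lemma wirtinger_add:
  assumes "g differentiable at z" "h differentiable at z"
  shows "wirtinger c i (\<lambda>x. g x + h x) z = wirtinger c i g z + wirtinger c i h z"
  unfolding wirtinger_has_derivative[OF has_derivative_add[OF assms[unfolded frechet_derivative_works]]]
  by (simp add: wirtinger_def diff_divide_distrib add_divide_distrib algebra_simps)

lemma wirtinger_mult:
  assumes "g differentiable at z" "h differentiable at z"
  shows "wirtinger c i (\<lambda>x. g x * h x) z = wirtinger c i g z * h z + g z * wirtinger c i h z"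
  unfolding wirtinger_has_derivative[OF has_derivative_mult[OF assms[unfolded frechet_derivative_works]]]
  by (simp add: wirtinger_def diff_divide_distrib add_divide_distrib algebra_simps)

lemma wirtinger_cmult:
  assumes "g differentiable at z"
  shows "wirtinger c i (\<lambda>x. a * g x) z = a * wirtinger c i g z"
  using wirtinger_mult[OF differentiable_const assms] by (simp add: wirtinger_const)

lemma wirtinger_minus:
  assumes "g differentiable at z"
  shows "wirtinger c i (\<lambda>x. - g x) z = - wirtinger c i g z"
  using wirtinger_cmult[OF assms, of _ _ "-1"] by simp

lemma wirtinger_diff:
  assumes "g differentiable at z" "h differentiable at z"
  shows "wirtinger c i (\<lambda>x. g x - h x) z = wirtinger c i g z - wirtinger c i h z"
  using wirtinger_add[OF assms(1) differentiable_minus[OF assms(2)]] wirtinger_minus[OF assms(2)] by simp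

lemma wirtinger_sum:
  assumes "\<And>a. a \<in> I \<Longrightarrow> g a differentiable at z"
  shows "wirtinger c i (\<lambda>x. \<Sum>a\<in>I. g a x) z = (\<Sum>a\<in>I. wirtinger c i (g a) z)"
  using assms
proof (induction I rule: infinite_finite_induct)
  case (insert a I)
  then have "(\<lambda>x. \<Sum>a\<in>I. g a x) differentiable at z"
    by (intro differentiable_sum) auto
  with insert show ?case by (simp add: wirtinger_add)
qed (simp_all add: wirtinger_const)

lemma wirtinger_prod:
  assumes "finite I" "\<And>a. a \<in> I \<Longrightarrow> g a differentiable at z"
  shows "(\<lambda>x. \<Prod>a\<in>I. g a x) differentiable at z"
    and "wirtinger c i (\<lambda>x. \<Prod>a\<in>I. g a x) z = (\<Sum>a\<in>I. wirtinger c i (g a) z * (\<Prod>b\<in>I - {a}. g b z))"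
proof -
  have "(\<lambda>x. \<Prod>a\<in>I. g a x) differentiable at z \<and>
    wirtinger c i (\<lambda>x. \<Prod>a\<in>I. g a x) z = (\<Sum>a\<in>I. wirtinger c i (g a) z * (\<Prod>b\<in>I - {a}. g b z))"
    using assms
  proof (induction I rule: finite_induct)
    case (insert a I)
    have *: "(\<Prod>b\<in>insert a I - {d}. g b z) = g a z * (\<Prod>b\<in>I - {d}. g b z)" if "d \<in> I" for d
    proof -
      have "insert a I - {d} = insert a (I - {d})" using insert.hyps that by auto
      then show ?thesis using insert.hyps by simp
    qed
    have "insert a I - {a} = I" using insert.hyps by auto
    then show ?case
      using insert by (auto simp: wirtinger_mult sum_distrib_left * mult_ac differentiable_mult intro!: sum.cong)
  qed (auto simp: wirtinger_const)
  then show "(\<lambda>x. \<Prod>a\<in>I. g a x) differentiable at z"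
    and "wirtinger c i (\<lambda>x. \<Prod>a\<in>I. g a x) z = (\<Sum>a\<in>I. wirtinger c i (g a) z * (\<Prod>b\<in>I - {a}. g b z))"
    by auto
qed

lemma wirtinger_compose:
  assumes "u differentiable at z" "(\<phi> has_field_derivative d) (at (u z))"
  shows "wirtinger c i (\<lambda>x. \<phi> (u x)) z = d * wirtinger c i u z"
  unfolding wirtinger_has_derivative[OF has_derivative_compose[OF assms(1)[unfolded frechet_derivative_works]
    assms(2)[unfolded has_field_derivative_def]]]
  by (simp add: wirtinger_def diff_divide_distrib algebra_simps)

lemma wirtinger_cong:
  assumes "open X" "z \<in> X" "g differentiable at z" "\<And>x. x \<in> X \<Longrightarrow> g x = h x"
  shows "wirtinger c i g z = wirtinger c i h z"
  using frechet_derivative_transform_within_open[OF assms(3,1,2,4)] by (simp add: wirtinger_def)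

lemma wirtinger_cnj:
  assumes "g differentiable at z"
  shows "wirtinger c i (\<lambda>x. cnj (g x)) z = cnj (wirtinger (cnj c) i g z)"
  using frechet_derivative_bounded_linear[OF bounded_linear_cnj assms] by (simp add: wirtinger_def)

lemma smooth_on_wirtinger:
  assumes "open X" "smooth_on g X"
  shows "smooth_on (wirtinger c i g) X"
  using smooth_on_mult[OF assms(1) smooth_on_const[OF assms(1), of "1/2"]
      smooth_on_diff[OF assms(1) smooth_on_frechet[OF assms(2), of "axis i 1"]
      smooth_on_mult[OF assms(1) smooth_on_const[OF assms(1), of c] smooth_on_frechet[OF assms(2), of "axis i \<i>"]]]]
  by (simp add: wirtinger_def[abs_def])

text \<open>Both sides expand into the same combination of four second directional derivatives, each
  of which is symmetric in its two directions.\<close>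

lemma wirtinger_commute:
  assumes "open X" "smooth_on g X" "z \<in> X"
  shows "wirtinger c i (wirtinger d j g) z = wirtinger d j (wirtinger c i g) z"
proof -
  define D where "D v g z = frechet_derivative g (at z) v" for v and g :: "complex^'a \<Rightarrow> complex" and z
  have *: "D v (wirtinger d j g) z = (D v (D (axis j 1) g) z - d * D v (D (axis j \<i>) g) z) / 2"
    for v d j
  proof -
    have "(D w g has_derivative (\<lambda>v. D v (D w g) z)) (at z)" for w
      using smooth_on_differentiable[OF smooth_on_frechet[OF assms(2)] assms(3), of w]
      by (simp add: frechet_derivative_works D_def[abs_def])
    then have "((\<lambda>z. (D (axis j 1) g z - d * D (axis j \<i>) g z) / 2) has_derivative
        (\<lambda>v. (D v (D (axis j 1) g) z - d * D v (D (axis j \<i>) g) z) / 2)) (at z)"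
      by (auto intro!: derivative_eq_intros)
    from frechet_derivative_at[OF this] show ?thesis
      by (simp add: wirtinger_def[abs_def] D_def[abs_def] fun_eq_iff)
  qed
  have w: "wirtinger c i g z = (D (axis i 1) g z - c * D (axis i \<i>) g z) / 2" for c i g z
    by (simp add: wirtinger_def D_def)
  have comm: "D v (D w g) z = D w (D v g) z" for v w
    unfolding D_def by (rule frechet_derivative_commute[OF assms(1,3,2)])
  show ?thesis
    unfolding w[of c i "wirtinger d j g"] w[of d j "wirtinger c i g"] *
      comm[of "axis i 1" "axis j 1"] comm[of "axis i \<i>" "axis j 1"] comm[of "axis i 1" "axis j \<i>"]
      comm[of "axis i \<i>" "axis j \<i>"]
    by (simp add: field_simps)
qed

text \<open>The product rule in the Leibniz expansion: collecting the terms whose factor from row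
  \<open>k\<close> is differentiated gives the determinant with that row replaced.\<close>

lemma wirtinger_det:
  fixes M :: "complex^'m::finite \<Rightarrow> complex^'n::finite^'n"
  assumes "\<And>i j. (\<lambda>x. M x $ i $ j) differentiable at z"
  shows "wirtinger c i (\<lambda>x. det (M x)) z =
    (\<Sum>k\<in>UNIV. det (\<chi> a. if a = k then (\<chi> b. wirtinger c i (\<lambda>x. M x $ k $ b) z) else row a (M z)))"
proof -
  define U where "U = (UNIV :: 'n set)"
  define Q where "Q = {p. p permutes U}"
  have fin: "finite U" "finite Q" by (auto simp: U_def Q_def intro: finite_permutations)
  have "wirtinger c i (\<lambda>x. det (M x)) z =
      wirtinger c i (\<lambda>x. \<Sum>p\<in>Q. of_int (sign p) * (\<Prod>a\<in>U. M x $ a $ p a)) z"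
    by (simp add: det_def U_def Q_def)
  also have "\<dots> = (\<Sum>p\<in>Q. of_int (sign p) * (\<Sum>k\<in>U. wirtinger c i (\<lambda>x. M x $ k $ p k) z * (\<Prod>b\<in>U - {k}. M z $ b $ p b)))"
    using assms fin by (simp add: wirtinger_sum wirtinger_cmult wirtinger_prod)
  also have "\<dots> = (\<Sum>k\<in>U. \<Sum>p\<in>Q. of_int (sign p) * (wirtinger c i (\<lambda>x. M x $ k $ p k) z * (\<Prod>b\<in>U - {k}. M z $ b $ p b)))"
    by (simp add: sum_distrib_left sum.swap[of _ U Q])
  also have "\<dots> = (\<Sum>k\<in>U. \<Sum>p\<in>Q. of_int (sign p) *
      (\<Prod>a\<in>U. (if a = k then (\<chi> b. wirtinger c i (\<lambda>x. M x $ k $ b) z) else row a (M z)) $ p a))"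
  proof (intro sum.cong refl arg_cong2[where f = "(*)"])
    fix k p assume "k \<in> U"
    then show "wirtinger c i (\<lambda>x. M x $ k $ p k) z * (\<Prod>b\<in>U - {k}. M z $ b $ p b) =
      (\<Prod>a\<in>U. (if a = k then (\<chi> b. wirtinger c i (\<lambda>x. M x $ k $ b) z) else row a (M z)) $ p a)"
      using fin by (simp add: prod.remove[of U k] row_def)
  qed
  finally show ?thesis by (simp add: det_def U_def Q_def)
qed

text \<open>Cramer's rule evaluates each summand of the row expansion of the derivative.\<close>

lemma wirtinger_det_inverse:
  fixes M :: "complex^'m::finite \<Rightarrow> complex^'n::finite^'n"
  assumes "\<And>i j. (\<lambda>x. M x $ i $ j) differentiable at z"
    and inv: "\<And>k l. (\<Sum>j\<in>UNIV. N $ k $ j * M z $ j $ l) = (if k = l then 1 else 0)"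
  shows "wirtinger c i (\<lambda>x. det (M x)) z =
    det (M z) * (\<Sum>k\<in>UNIV. \<Sum>l\<in>UNIV. N $ l $ k * wirtinger c i (\<lambda>x. M x $ k $ l) z)"
proof -
  have "det (\<chi> a. if a = k then (\<chi> b. wirtinger c i (\<lambda>x. M x $ k $ b) z) else row a (M z)) =
      (\<Sum>l\<in>UNIV. N $ l $ k * wirtinger c i (\<lambda>x. M x $ k $ l) z) * det (M z)" for k
  proof -
    \<comment> \<open>The coefficients of the differentiated row as a combination of the rows of
      \<open>M z\<close>, found by multiplying it with the inverse \<open>N\<close>.\<close>
    define x where "x = (\<chi> j. \<Sum>l\<in>UNIV. wirtinger c i (\<lambda>x. M x $ k $ l) z * N $ l $ j)"
    have "(\<Sum>j\<in>UNIV. x $ j *s row j (M z)) $ b = wirtinger c i (\<lambda>x. M x $ k $ b) z" for b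
    proof -
      have "(\<Sum>j\<in>UNIV. x $ j *s row j (M z)) $ b =
        (\<Sum>j\<in>UNIV. \<Sum>l\<in>UNIV. wirtinger c i (\<lambda>x. M x $ k $ l) z * (N $ l $ j * M z $ j $ b))"
        by (simp add: x_def row_def sum_distrib_right mult.assoc)
      also have "\<dots> = (\<Sum>l\<in>UNIV. wirtinger c i (\<lambda>x. M x $ k $ l) z * (\<Sum>j\<in>UNIV. N $ l $ j * M z $ j $ b))"
        by (subst sum.swap) (simp add: sum_distrib_left)
      finally show ?thesis by (simp add: inv if_distrib[of "(*) _"] cong: if_cong)
    qed
    then have "(\<chi> b. wirtinger c i (\<lambda>x. M x $ k $ b) z) = (\<Sum>j\<in>UNIV. x $ j *s row j (M z))"
      by (simp add: vec_eq_iff)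
    then show ?thesis
      using cramer_lemma_transpose[of k x "M z"] by (simp add: x_def mult.commute cong: if_cong)
  qed
  then show ?thesis
    using assms(1) by (simp add: wirtinger_det sum_distrib_left mult.commute flip: sum_distrib_right)
qed

lemma wirtinger_smooth_cong:
  assumes "open X" "smooth_on g X" "\<And>x. x \<in> X \<Longrightarrow> g x = h x" "z \<in> X"
  shows "wirtinger c i g z = wirtinger c i h z"
  using assms by (intro wirtinger_cong[of X]) (auto intro: smooth_on_differentiable)

text \<open>The inner exchange is valid on the whole open set, not only at \<open>z\<close>, and may
  therefore be differentiated.\<close>

lemma wirtinger_commute_inner:
  assumes "open X" "smooth_on g X" "z \<in> X"
  shows "wirtinger c i (wirtinger d j (wirtinger e k g)) z = wirtinger c i (wirtinger e k (wirtinger d j g)) z"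
  using assms by (intro wirtinger_smooth_cong[of X] smooth_on_wirtinger wirtinger_commute)

subsection \<open>Hermitian matrices\<close>

lemma invertible_matrix_inv:
  fixes A :: "complex^'n::finite^'n"
  assumes "det A \<noteq> 0"
  shows "(\<Sum>j\<in>UNIV. matrix_inv A $ i $ j * A $ j $ k) = (if i = k then 1 else 0)"
    and "(\<Sum>j\<in>UNIV. A $ i $ j * matrix_inv A $ j $ k) = (if i = k then 1 else 0)"
proof -
  have "invertible A" using assms by (simp add: invertible_det_nz)
  then have *: "A ** matrix_inv A = mat 1 \<and> matrix_inv A ** A = mat 1"
    unfolding invertible_def matrix_inv_def by (rule someI_ex)
  have "(matrix_inv A ** A) $ i $ k = mat 1 $ i $ k" "(A ** matrix_inv A) $ i $ k = mat 1 $ i $ k"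
    using * by simp_all
  then show "(\<Sum>j\<in>UNIV. matrix_inv A $ i $ j * A $ j $ k) = (if i = k then 1 else 0)"
    and "(\<Sum>j\<in>UNIV. A $ i $ j * matrix_inv A $ j $ k) = (if i = k then 1 else 0)"
    by (simp_all add: matrix_matrix_mult_def mat_def)
qed

text \<open>Writes each entry of the inverse as a quotient of polynomials in the entries of
  \<open>A\<close>, from which the smoothness of the inverse metric follows.\<close>

lemma matrix_inv_cramer:
  fixes A :: "complex^'n::finite^'n"
  assumes "det A \<noteq> 0"
  shows "matrix_inv A $ a $ b = det (\<chi> i j. if j = a then (if i = b then 1 else 0) else A $ i $ j) / det A"
proof -
  have "A *v (\<chi> a. matrix_inv A $ a $ b) = axis b 1"
    using invertible_matrix_inv(2)[OF assms] by (simp add: vec_eq_iff matrix_vector_mult_def axis_def)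
  then have "(\<chi> a. matrix_inv A $ a $ b) = (\<chi> k. det (\<chi> i j. if j = k then axis b 1 $ i else A $ i $ j) / det A)"
    using cramer[OF assms] by blast
  then have "matrix_inv A $ a $ b = det (\<chi> i j. if j = a then axis b 1 $ i else A $ i $ j) / det A"
    by (simp add: vec_eq_iff)
  then show ?thesis by (simp add: axis_def cong: if_cong)
qed

lemma pos_def_hermitianD:
  fixes A :: "complex^'n::finite^'n"
  assumes "pos_def_hermitian A"
  shows "cnj (A $ i $ j) = A $ j $ i"
    and "v \<noteq> 0 \<Longrightarrow> 0 < Re (\<Sum>i\<in>UNIV. \<Sum>j\<in>UNIV. A $ i $ j * v $ i * cnj (v $ j))"
  using assms unfolding pos_def_hermitian_def by (metis, blast)

text \<open>A kernel vector would make the form vanish. The transpose occurs because the form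
  contracts the unconjugated vector with the row index.\<close>

lemma pos_def_hermitian_det_nz:
  fixes A :: "complex^'n::finite^'n"
  assumes "pos_def_hermitian A"
  shows "det A \<noteq> 0"
proof -
  have "v = 0" if "transpose A *v v = 0" for v
  proof (rule ccontr)
    assume "v \<noteq> 0"
    then have "0 < Re (\<Sum>i\<in>UNIV. \<Sum>j\<in>UNIV. A $ i $ j * v $ i * cnj (v $ j))"
      by (rule pos_def_hermitianD(2)[OF assms])
    also have "(\<Sum>i\<in>UNIV. \<Sum>j\<in>UNIV. A $ i $ j * v $ i * cnj (v $ j)) =
        (\<Sum>j\<in>UNIV. (transpose A *v v) $ j * cnj (v $ j))"
      by (subst sum.swap) (simp add: matrix_vector_mult_def transpose_def sum_distrib_right)
    finally show False using that by simp
  qed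
  then have "invertible (transpose A)"
    by (simp add: invertible_left_inverse matrix_left_invertible_ker)
  then show ?thesis by (simp add: invertible_det_nz)
qed

lemma det_hermitian_real:
  fixes A :: "complex^'n::finite^'n"
  assumes "\<And>i j. cnj (A $ i $ j) = A $ j $ i"
  shows "Im (det A) = 0"
proof -
  have "cnj (det A) = det (transpose A)"
    using assms unfolding det_def by (simp add: transpose_def)
  then have "cnj (det A) = det A" by simp
  then have "- Im (det A) = Im (det A)"
    by (metis cnj.sel(2))
  then show ?thesis by simp
qed

text \<open>The segment from the identity to \<open>A\<close> consists of positive definite
  matrices. Along it the determinant is real, continuous and nonzero, and it starts at 1, so it
  cannot change sign.\<close>

lemma pos_def_hermitian_det_pos:
  fixes A :: "complex^'n::finite^'n"
  assumes A: "pos_def_hermitian A"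
  shows "Re (det A) > 0"
proof (rule ccontr)
  assume neg: "\<not> Re (det A) > 0"
  define M :: "real \<Rightarrow> complex^'n^'n" where
    "M t = (\<chi> i j. of_real t * A $ i $ j + of_real (1 - t) * (if i = j then 1 else 0))" for t
  have pd: "pos_def_hermitian (M t)" if "0 \<le> t" "t \<le> 1" for t
    unfolding pos_def_hermitian_def
  proof (intro conjI allI impI)
    fix i j
    show "M t $ j $ i = cnj (M t $ i $ j)"
      by (simp add: M_def pos_def_hermitianD(1)[OF A] eq_commute[of i j])
  next
    fix v :: "complex^'n" assume v: "v \<noteq> 0"
    then obtain k where k: "v $ k \<noteq> 0" by (auto simp: vec_eq_iff)
    define q where "q = Re (\<Sum>i\<in>UNIV. \<Sum>j\<in>UNIV. A $ i $ j * v $ i * cnj (v $ j))"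
    define r where "r = (\<Sum>i\<in>UNIV. (cmod (v $ i))\<^sup>2)"
    have q: "q > 0" unfolding q_def by (rule pos_def_hermitianD(2)[OF A v])
    have r: "r > 0" using k unfolding r_def by (intro sum_pos2[of _ k]) auto
    have "(\<Sum>i\<in>UNIV. \<Sum>j\<in>UNIV. M t $ i $ j * v $ i * cnj (v $ j)) =
      of_real t * (\<Sum>i\<in>UNIV. \<Sum>j\<in>UNIV. A $ i $ j * v $ i * cnj (v $ j)) +
      of_real (1 - t) * (\<Sum>i\<in>UNIV. \<Sum>j\<in>UNIV. if i = j then v $ i * cnj (v $ j) else 0)"
      unfolding sum_distrib_left sum.distrib[symmetric]
      by (intro sum.cong refl) (simp add: M_def algebra_simps)
    then have "Re (\<Sum>i\<in>UNIV. \<Sum>j\<in>UNIV. M t $ i $ j * v $ i * cnj (v $ j)) = t * q + (1 - t) * r"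
      by (simp add: q_def r_def flip: complex_norm_square of_real_power of_real_sum)
    also have "\<dots> > 0"
      using q r that by (cases "t = 0") (auto intro!: add_pos_nonneg)
    finally show "0 < Re (\<Sum>i\<in>UNIV. \<Sum>j\<in>UNIV. M t $ i $ j * v $ i * cnj (v $ j))" .
  qed
  have "continuous_on {0..1} (\<lambda>t. Re (det (M t)))"
    unfolding det_def M_def by (simp del: of_real_diff) (intro continuous_intros)
  moreover have "M 0 = mat 1" "M 1 = A" by (auto simp: M_def mat_def vec_eq_iff)
  ultimately obtain t where t: "0 \<le> t" "t \<le> 1" "Re (det (M t)) = 0"
    using neg IVT2'[of "\<lambda>t. Re (det (M t))" 1 0 0] by auto
  have "Im (det (M t)) = 0"
    by (intro det_hermitian_real pos_def_hermitianD(1) pd t)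
  with t pos_def_hermitian_det_nz[OF pd[OF t(1,2)]] show False
    by (simp add: complex_eq_iff)
qed

section \<open>Positive semidefinite forms and nonnegative tensor squares\<close>

definition hermitian_psd :: "('n::finite \<Rightarrow> 'n \<Rightarrow> complex) \<Rightarrow> bool" where
  "hermitian_psd A \<longleftrightarrow> (\<forall>i j. A j i = cnj (A i j)) \<and>
     (\<forall>v. 0 \<le> Re (\<Sum>i\<in>UNIV. \<Sum>j\<in>UNIV. A i j * v i * cnj (v j)))"

text \<open>Transposing the matrix amounts to evaluating the original form at the conjugate vector.
  It is needed for the mixed Hessian, whose second index is antiholomorphic and so is contracted
  with the transposed inverse metric.\<close>

lemma hermitian_psd_transpose:
  assumes "hermitian_psd A"
  shows "hermitian_psd (\<lambda>i j. A j i)"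
proof -
  have eq: "(\<Sum>i\<in>UNIV. \<Sum>j\<in>UNIV. A j i * v i * cnj (v j)) =
      (\<Sum>i\<in>UNIV. \<Sum>j\<in>UNIV. A i j * cnj (v i) * cnj (cnj (v j)))" for v
    by (subst sum.swap) (simp add: mult_ac)
  have h: "A i j = cnj (A j i)" for i j
    using assms unfolding hermitian_psd_def by blast
  have p: "0 \<le> Re (\<Sum>i\<in>UNIV. \<Sum>j\<in>UNIV. A i j * cnj (v i) * cnj (cnj (v j)))" for v
    using assms[unfolded hermitian_psd_def, THEN conjunct2, rule_format, of "\<lambda>i. cnj (v i)"] .
  show ?thesis
    unfolding hermitian_psd_def eq using h p by blast
qed

text \<open>Moving \<open>v\<close> along one coordinate gives a quadratic polynomial in
  \<open>t\<close>; suitable values of \<open>t\<close> then give the inequalities used in the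
  Cholesky step.\<close>

lemma hermitian_form_shift:
  fixes A :: "'n::finite \<Rightarrow> 'n \<Rightarrow> complex"
  assumes "\<And>i j. A j i = cnj (A i j)"
  shows "(\<Sum>i\<in>UNIV. \<Sum>j\<in>UNIV. A i j * (v i + (if i = k then t else 0)) * cnj (v j + (if j = k then t else 0))) =
    (\<Sum>i\<in>UNIV. \<Sum>j\<in>UNIV. A i j * v i * cnj (v j)) + cnj t * (\<Sum>i\<in>UNIV. A i k * v i)
      + t * cnj (\<Sum>i\<in>UNIV. A i k * v i) + t * cnj t * A k k"
proof -
  have "(\<Sum>i\<in>UNIV. \<Sum>j\<in>UNIV. A i j * (v i + (if i = k then t else 0)) * cnj (v j + (if j = k then t else 0))) =
    (\<Sum>i\<in>UNIV. \<Sum>j\<in>UNIV. A i j * v i * cnj (v j)) + 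
    (\<Sum>i\<in>UNIV. \<Sum>j\<in>UNIV. (if j = k then A i j * v i * cnj t else 0)) +
    (\<Sum>i\<in>UNIV. \<Sum>j\<in>UNIV. if i = k then A i j * t * cnj (v j) else 0) +
    (\<Sum>i\<in>UNIV. \<Sum>j\<in>UNIV. if i = k then (if j = k then A i j * t * cnj t else 0) else 0)"
    unfolding sum.distrib[symmetric] by (intro sum.cong refl) (simp add: algebra_simps)
  also have "(\<Sum>i\<in>UNIV. \<Sum>j\<in>UNIV. if i = k then A i j * t * cnj (v j) else 0) = (\<Sum>j\<in>UNIV. A k j * t * cnj (v j))"
    by (subst sum.swap) simp
  also have "(\<Sum>i\<in>UNIV. \<Sum>j\<in>UNIV. if i = k then (if j = k then A i j * t * cnj t else 0) else 0) = A k k * t * cnj t"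
    by (subst sum.swap) simp
  also have "(\<Sum>j\<in>UNIV. A k j * t * cnj (v j)) = t * cnj (\<Sum>i\<in>UNIV. A i k * v i)"
    by (simp add: sum_distrib_left mult_ac flip: assms)
  finally show ?thesis
    by (simp add: sum_distrib_left mult_ac)
qed

text \<open>A Cholesky decomposition: each step splits off the rank-one part belonging to one index.\<close>

lemma hermitian_psd_decomposition_on:
  fixes A :: "'n::finite \<Rightarrow> 'n \<Rightarrow> complex"
  assumes "finite S" "hermitian_psd A" "\<And>i j. A i j \<noteq> 0 \<Longrightarrow> i \<in> S \<and> j \<in> S"
  shows "\<exists>E. \<forall>i j. A i j = (\<Sum>a\<in>S. E a i * cnj (E a j))"
  using assms
proof (induction S arbitrary: A rule: finite_induct)
  case empty
  then show ?case by auto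
next
  case (insert k S)
  have herm: "A j i = cnj (A i j)" for i j
    using insert.prems(1) unfolding hermitian_psd_def by blast
  have pos: "0 \<le> Re (\<Sum>i\<in>UNIV. \<Sum>j\<in>UNIV. A i j * v i * cnj (v j))" for v
    using insert.prems(1) unfolding hermitian_psd_def by blast
  define d where "d = Re (A k k)"
  have Akk: "A k k = of_real d"
  proof -
    have "Im (A k k) = - Im (A k k)" by (metis herm cnj.sel(2))
    then show ?thesis by (simp add: d_def complex_eq_iff)
  qed
  have shift: "0 \<le> Re (\<Sum>i\<in>UNIV. \<Sum>j\<in>UNIV. A i j * v i * cnj (v j)) + 2 * Re (cnj t * (\<Sum>i\<in>UNIV. A i k * v i))
      + (cmod t)\<^sup>2 * d" for v t
  proof -
    have "Re (t * cnj t * A k k) = (cmod t)\<^sup>2 * d"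
      by (simp add: Akk flip: complex_norm_square of_real_power)
    moreover have "Re (t * cnj s) = Re (cnj t * s)" for s by simp
    ultimately have *: "Re (q + cnj t * s + t * cnj s + t * cnj t * A k k) =
        Re q + 2 * Re (cnj t * s) + (cmod t)\<^sup>2 * d" for q s
      by (simp only: plus_complex.sel)
    show ?thesis
      using pos[of "\<lambda>i. v i + (if i = k then t else 0)"] unfolding hermitian_form_shift[OF herm] * .
  qed
  have d0: "d \<ge> 0"
    using shift[of "\<lambda>_. 0" 1] by simp
  show ?case
  proof (cases "d = 0")
    case True
    \<comment> \<open>A vanishing diagonal entry makes the form affine in \<open>t\<close>, so
      nonnegativity forces its linear coefficient, the column entry, to vanish.\<close>
    have zero: "A j k = 0" for j
    proof (rule ccontr)
      assume "A j k \<noteq> 0"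
      then have m: "(cmod (A j k))\<^sup>2 > 0" by simp
      have 1: "(\<Sum>i\<in>UNIV. A i k * (if i = j then 1 else 0)) = A j k"
        by (simp add: mult_delta_right)
      have 2: "(\<Sum>i\<in>UNIV. \<Sum>l\<in>UNIV. A i l * (if i = j then 1 else 0) * cnj (if l = j then 1 else 0)) = A j j"
      proof -
        have "(\<Sum>i\<in>UNIV. \<Sum>l\<in>UNIV. A i l * (if i = j then 1 else 0) * cnj (if l = j then 1 else 0)) =
            (\<Sum>l\<in>UNIV. \<Sum>i\<in>UNIV. if i = j then (if l = j then A i l else 0) else 0)"
          by (subst sum.swap) (intro sum.cong refl, simp)
        then show ?thesis by simp
      qed
      \<comment> \<open>With \<open>t = - c * A j k\<close> the linear term becomes -2(|Re (A j j)|
        + 1), which outweighs the constant term \<open>Re (A j j)\<close>.\<close>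
      define c where "c = (\<bar>Re (A j j)\<bar> + 1) / (cmod (A j k))\<^sup>2"
      have 3: "Re (cnj (- of_real c * A j k) * A j k) = - (c * (cmod (A j k))\<^sup>2)"
        unfolding cmod_power2 by (simp add: power2_eq_square algebra_simps)
      then have "0 \<le> Re (A j j) - 2 * (c * (cmod (A j k))\<^sup>2)"
        using shift[of "\<lambda>i. if i = j then 1 else 0" "- of_real c * A j k"] unfolding 1 2 3 True by simp
      also have "c * (cmod (A j k))\<^sup>2 = \<bar>Re (A j j)\<bar> + 1" using m by (simp add: c_def)
      finally have "0 \<le> Re (A j j) - 2 * (\<bar>Re (A j j)\<bar> + 1)" .
      moreover have "r - 2 * (\<bar>r\<bar> + 1) < 0" for r :: real by (cases "r \<ge> 0") auto
      ultimately show False using not_le by blast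
    qed
    then have zero': "A k j = 0" for j using herm[of k j] by simp
    have "A i j \<noteq> 0 \<Longrightarrow> i \<in> S \<and> j \<in> S" for i j
      using insert.prems(2)[of i j] zero zero' by auto
    from insert.IH[OF insert.prems(1) this]
    obtain E where E: "\<forall>i j. A i j = (\<Sum>a\<in>S. E a i * cnj (E a j))"
      by blast
    \<comment> \<open>Row and column \<open>k\<close> vanish, so the new index contributes the zero
      vector.\<close>
    have "(\<Sum>a\<in>insert k S. (E(k := \<lambda>_. 0)) a i * cnj ((E(k := \<lambda>_. 0)) a j)) = (\<Sum>a\<in>S. E a i * cnj (E a j))" for i j
      using insert.hyps by (auto intro!: sum.cong)
    then show ?thesis
      by (intro exI[of _ "E(k := \<lambda>_. 0)"]) (simp only: E[rule_format] simp_thms)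
  next
    case False
    then have d: "d > 0" using d0 by simp
    \<comment> \<open>The Schur complement of the entry at \<open>k\<close>: it is supported on
      \<open>S\<close>, since row and column \<open>k\<close> cancel.\<close>
    define A' where "A' i j = A i j - A i k * A k j / of_real d" for i j
    have "hermitian_psd A'"
      unfolding hermitian_psd_def
    proof (intro conjI allI)
      fix i j show "A' j i = cnj (A' i j)"
        unfolding A'_def by (simp add: mult.commute flip: herm)
    next
      fix v :: "'n \<Rightarrow> complex"
      define s where "s = (\<Sum>i\<in>UNIV. A i k * v i)"
      have "(\<Sum>i\<in>UNIV. \<Sum>j\<in>UNIV. A' i j * v i * cnj (v j)) =
        (\<Sum>i\<in>UNIV. \<Sum>j\<in>UNIV. A i j * v i * cnj (v j)) -
        (\<Sum>i\<in>UNIV. A i k * v i) * (\<Sum>j\<in>UNIV. A k j * cnj (v j)) / of_real d"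
        unfolding sum_product sum_divide_distrib sum_subtractf[symmetric]
        by (intro sum.cong refl) (simp add: A'_def algebra_simps)
      also have "(\<Sum>j\<in>UNIV. A k j * cnj (v j)) = cnj s"
        unfolding s_def by (simp flip: herm)
      also have "(\<Sum>i\<in>UNIV. A i k * v i) = s" by (simp add: s_def)
      finally have "Re (\<Sum>i\<in>UNIV. \<Sum>j\<in>UNIV. A' i j * v i * cnj (v j)) =
        Re (\<Sum>i\<in>UNIV. \<Sum>j\<in>UNIV. A i j * v i * cnj (v j)) - (cmod s)\<^sup>2 / d"
        by (simp flip: complex_norm_square of_real_power of_real_divide)
      \<comment> \<open>The value \<open>t = - s / d\<close> minimises the quadratic polynomial in
        \<open>t\<close>, and its minimum is exactly the form of the Schur complement at
        \<open>v\<close>.\<close>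
      moreover have "Re (cnj (- s / of_real d) * s) = - ((cmod s)\<^sup>2 / d)"
        using d unfolding cmod_power2 by (simp add: power2_eq_square field_simps)
      moreover have "(cmod (- s / of_real d))\<^sup>2 * d = (cmod s)\<^sup>2 / d"
        using d by (simp add: norm_divide power2_eq_square)
      ultimately show "0 \<le> Re (\<Sum>i\<in>UNIV. \<Sum>j\<in>UNIV. A' i j * v i * cnj (v j))"
        using shift[of v "- s / of_real d"] unfolding s_def[symmetric] by linarith
    qed
    moreover have "A' k j = 0" "A' j k = 0" for j
      using d by (auto simp: A'_def Akk)
    then have "A' i j \<noteq> 0 \<Longrightarrow> i \<in> S \<and> j \<in> S" for i j
      using insert.prems(2)[of i j] insert.prems(2)[of i k] insert.prems(2)[of k j]
      by (metis A'_def cancel_comm_monoid_add_class.diff_cancel diff_zero div_0 insert_iff mult_zero_left mult_zero_right)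
    ultimately obtain E where E: "\<forall>i j. A' i j = (\<Sum>a\<in>S. E a i * cnj (E a j))"
      using insert.IH[of A'] by blast
    \<comment> \<open>The split-off rank-one part is the product of \<open>e\<close> with its
      conjugate; dividing by \<open>sqrt d\<close> shares the factor \<open>1 / d\<close>
      evenly.\<close>
    define e where "e i = A i k / of_real (sqrt d)" for i
    have "e i * cnj (e j) = A i k * A k j / of_real d" for i j
      using d by (simp add: e_def flip: of_real_mult herm)
    then have "A i j = e i * cnj (e j) + (\<Sum>a\<in>S. E a i * cnj (E a j))" for i j
      by (simp add: A'_def flip: E[rule_format])
    moreover have "(\<Sum>a\<in>insert k S. (E(k := e)) a i * cnj ((E(k := e)) a j)) = e i * cnj (e j) + (\<Sum>a\<in>S. E a i * cnj (E a j))" for i j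
      using insert.hyps by (auto intro!: sum.cong)
    ultimately show ?thesis
      by (intro exI[of _ "E(k := e)"]) (simp only: simp_thms)
  qed
qed

text \<open>Factoring \<open>A\<close> turns the sum into a sum over \<open>a\<close> of values of
  the form \<open>C\<close> at the vectors \<open>w a\<close>, each of them nonnegative.\<close>

lemma hermitian_psd_tensor_nonneg:
  fixes A C :: "'n::finite \<Rightarrow> 'n \<Rightarrow> complex"
  assumes "hermitian_psd A" "hermitian_psd C"
  shows "0 \<le> Re (\<Sum>i\<in>UNIV. \<Sum>j\<in>UNIV. \<Sum>k\<in>UNIV. \<Sum>l\<in>UNIV. A i j * C k l * T i k * cnj (T j l))"
proof -
  obtain E :: "'n \<Rightarrow> 'n \<Rightarrow> complex" where E: "\<And>i j. A i j = (\<Sum>a\<in>UNIV. E a i * cnj (E a j))"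
    using hermitian_psd_decomposition_on[OF finite_class.finite_UNIV assms(1)] by auto
  define w where "w a k = (\<Sum>i\<in>UNIV. E a i * T i k)" for a k
  have "(\<Sum>i\<in>UNIV. \<Sum>j\<in>UNIV. \<Sum>k\<in>UNIV. \<Sum>l\<in>UNIV. A i j * C k l * T i k * cnj (T j l)) =
    (\<Sum>i\<in>UNIV. \<Sum>j\<in>UNIV. \<Sum>k\<in>UNIV. \<Sum>l\<in>UNIV. \<Sum>a\<in>UNIV. C k l * (E a i * T i k) * cnj (E a j * T j l))"
    by (simp add: E sum_distrib_left sum_distrib_right mult_ac)
  also have "\<dots> = (\<Sum>a\<in>UNIV. \<Sum>k\<in>UNIV. \<Sum>l\<in>UNIV. \<Sum>i\<in>UNIV. \<Sum>j\<in>UNIV. C k l * (E a i * T i k) * cnj (E a j * T j l))"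
    unfolding sum.cartesian_product
    by (rule sum.reindex_bij_witness[of _ "\<lambda>(a,k,l,i,j). (i,j,k,l,a)" "\<lambda>(i,j,k,l,a). (a,k,l,i,j)"]) auto
  also have "\<dots> = (\<Sum>a\<in>UNIV. \<Sum>k\<in>UNIV. \<Sum>l\<in>UNIV. C k l * w a k * cnj (w a l))"
    by (simp add: w_def sum_distrib_left sum_distrib_right mult_ac)
  finally have eq: "(\<Sum>i\<in>UNIV. \<Sum>j\<in>UNIV. \<Sum>k\<in>UNIV. \<Sum>l\<in>UNIV. A i j * C k l * T i k * cnj (T j l)) = \<dots>" .
  have "0 \<le> Re (\<Sum>k\<in>UNIV. \<Sum>l\<in>UNIV. C k l * w a k * cnj (w a l))" for a
    using assms(2) unfolding hermitian_psd_def by blast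
  then show ?thesis
    unfolding eq Re_sum[of _ "UNIV :: 'n set", of "\<lambda>a. \<Sum>k\<in>UNIV. \<Sum>l\<in>UNIV. C k l * w a k * cnj (w a l)"]
    by (intro sum_nonneg)
qed

text \<open>The expansion of the squared norm of \<open>T\<close> plus \<open>c\<close> times the
  tensor product of \<open>v\<close> and \<open>w\<close>. Both completed squares of the final
  estimate are instances.\<close>

lemma hermitian_psd_tensor_shift_nonneg:
  fixes A C T :: "'n::finite \<Rightarrow> 'n \<Rightarrow> complex" and v w :: "'n \<Rightarrow> complex" and c :: real
  assumes A: "hermitian_psd A" and C: "hermitian_psd C"
  shows "0 \<le> Re (\<Sum>i\<in>UNIV. \<Sum>j\<in>UNIV. \<Sum>k\<in>UNIV. \<Sum>l\<in>UNIV. A i j * C k l * T i k * cnj (T j l))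
    + 2 * c * Re (\<Sum>i\<in>UNIV. \<Sum>k\<in>UNIV. (\<Sum>j\<in>UNIV. A i j * cnj (v j)) * (\<Sum>l\<in>UNIV. C k l * cnj (w l)) * T i k)
    + c\<^sup>2 * Re ((\<Sum>i\<in>UNIV. \<Sum>j\<in>UNIV. A i j * v i * cnj (v j)) * (\<Sum>k\<in>UNIV. \<Sum>l\<in>UNIV. C k l * w k * cnj (w l)))"
proof -
  have hA: "cnj (A i j) = A j i" and hC: "cnj (C i j) = C j i" for i j
    using A C unfolding hermitian_psd_def by metis+
  define Z where "Z = (\<Sum>i\<in>UNIV. \<Sum>k\<in>UNIV. (\<Sum>j\<in>UNIV. A i j * cnj (v j)) * (\<Sum>l\<in>UNIV. C k l * cnj (w l)) * T i k)"
  have 1: "(\<Sum>i\<in>UNIV. \<Sum>j\<in>UNIV. \<Sum>k\<in>UNIV. \<Sum>l\<in>UNIV. A i j * C k l * T i k * cnj (v j * w l)) = Z"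
    unfolding Z_def sum_distrib_left sum_distrib_right sum.cartesian_product
    by (rule sum.reindex_bij_witness[of _ "\<lambda>(i,k,l,j). (i,j,k,l)" "\<lambda>(i,j,k,l). (i,k,l,j)"]) auto
  have 2: "(\<Sum>i\<in>UNIV. \<Sum>j\<in>UNIV. \<Sum>k\<in>UNIV. \<Sum>l\<in>UNIV. A i j * C k l * (v i * w k) * cnj (T j l)) = cnj Z"
    unfolding Z_def sum_distrib_left sum_distrib_right sum.cartesian_product cnj_sum
    by (rule sum.reindex_bij_witness[of _ "\<lambda>(j,l,k,i). (i,j,k,l)" "\<lambda>(i,j,k,l). (j,l,k,i)"]) (auto simp: hA hC)
  have 3: "(\<Sum>i\<in>UNIV. \<Sum>j\<in>UNIV. \<Sum>k\<in>UNIV. \<Sum>l\<in>UNIV. A i j * C k l * (v i * w k) * cnj (v j * w l)) =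
      (\<Sum>i\<in>UNIV. \<Sum>j\<in>UNIV. A i j * v i * cnj (v j)) * (\<Sum>k\<in>UNIV. \<Sum>l\<in>UNIV. C k l * w k * cnj (w l))"
    unfolding sum_distrib_left sum_distrib_right sum.cartesian_product
    by (rule sum.reindex_bij_witness[of _ "\<lambda>((k,l),(i,j)). (i,j,k,l)" "\<lambda>(i,j,k,l). ((k,l),(i,j))"]) auto
  have "(\<Sum>i\<in>UNIV. \<Sum>j\<in>UNIV. \<Sum>k\<in>UNIV. \<Sum>l\<in>UNIV. A i j * C k l *
        (T i k + of_real c * (v i * w k)) * cnj (T j l + of_real c * (v j * w l))) =
      (\<Sum>i\<in>UNIV. \<Sum>j\<in>UNIV. \<Sum>k\<in>UNIV. \<Sum>l\<in>UNIV. A i j * C k l * T i k * cnj (T j l)) +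
      of_real c * (\<Sum>i\<in>UNIV. \<Sum>j\<in>UNIV. \<Sum>k\<in>UNIV. \<Sum>l\<in>UNIV. A i j * C k l * T i k * cnj (v j * w l)) +
      of_real c * (\<Sum>i\<in>UNIV. \<Sum>j\<in>UNIV. \<Sum>k\<in>UNIV. \<Sum>l\<in>UNIV. A i j * C k l * (v i * w k) * cnj (T j l)) +
      of_real (c\<^sup>2) * (\<Sum>i\<in>UNIV. \<Sum>j\<in>UNIV. \<Sum>k\<in>UNIV. \<Sum>l\<in>UNIV. A i j * C k l * (v i * w k) * cnj (v j * w l))"
    unfolding sum_distrib_left sum.distrib[symmetric]
    by (intro sum.cong refl) (simp add: algebra_simps power2_eq_square)
  also have "\<dots> = (\<Sum>i\<in>UNIV. \<Sum>j\<in>UNIV. \<Sum>k\<in>UNIV. \<Sum>l\<in>UNIV. A i j * C k l * T i k * cnj (T j l)) +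
      of_real c * Z + of_real c * cnj Z + of_real (c\<^sup>2) *
      ((\<Sum>i\<in>UNIV. \<Sum>j\<in>UNIV. A i j * v i * cnj (v j)) * (\<Sum>k\<in>UNIV. \<Sum>l\<in>UNIV. C k l * w k * cnj (w l)))"
    unfolding 1 2 3 ..
  finally have eq: "(\<Sum>i\<in>UNIV. \<Sum>j\<in>UNIV. \<Sum>k\<in>UNIV. \<Sum>l\<in>UNIV. A i j * C k l *
        (T i k + of_real c * (v i * w k)) * cnj (T j l + of_real c * (v j * w l))) = \<dots>" .
  have re: "Re (x + of_real c * z + of_real c * cnj z + of_real d * y) = Re x + 2 * c * Re z + d * Re y" for x y z d
    by simp
  show ?thesis
    using hermitian_psd_tensor_nonneg[OF A C, of "\<lambda>i k. T i k + of_real c * (v i * w k)"]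
    unfolding eq re Z_def .
qed

lemma hermitian_contraction_real:
  fixes B U :: "'n::finite \<Rightarrow> 'n \<Rightarrow> complex"
  assumes "\<And>i j. cnj (B i j) = B j i" "\<And>i j. cnj (U i j) = U j i"
  shows "of_real (Re (\<Sum>i\<in>UNIV. \<Sum>j\<in>UNIV. B i j * U i j)) = (\<Sum>i\<in>UNIV. \<Sum>j\<in>UNIV. B i j * U i j)"
proof -
  have "cnj (\<Sum>i\<in>UNIV. \<Sum>j\<in>UNIV. B i j * U i j) = (\<Sum>i\<in>UNIV. \<Sum>j\<in>UNIV. B i j * U i j)"
    by (subst sum.swap) (simp add: assms)
  then show ?thesis
    unfolding Reals_cnj_iff[symmetric] by (rule of_real_Re)
qed

subsection \<open>The Bochner formula\<close>

text \<open>
  The index bookkeeping behind the Bochner formula. Reading \<open>B\<close> as the inverse metric,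
  \<open>G p q m\<close> and \<open>H p q n\<close> as the holomorphic and antiholomorphic derivatives of \<open>f\<^bsub>p q\<^esub>\<close>,
  \<open>U\<close> as the complex Hessian of the function and \<open>X\<close>, \<open>Y\<close> as its two gradients, both sides
  contain the same terms, up to the symmetry of the third derivatives of the potential.
\<close>

lemma bochner_contraction:
  fixes B U T T' :: "'n::finite \<Rightarrow> 'n \<Rightarrow> complex" and G H W W' :: "'n \<Rightarrow> 'n \<Rightarrow> 'n \<Rightarrow> complex"
    and Q :: "'n \<Rightarrow> 'n \<Rightarrow> 'n \<Rightarrow> 'n \<Rightarrow> complex" and X Y :: "'n \<Rightarrow> complex"
  assumes G: "\<And>p q m. G p q m = G m q p" and H: "\<And>p q n. H p q n = H p n q"
    and XE: "\<And>p n. XE p n = (\<Sum>j\<in>UNIV. B p j * T' j n)"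
    and YE: "\<And>q n. YE q n = (\<Sum>r\<in>UNIV. B r q * (U r n - (\<Sum>s\<in>UNIV. Y s * H r s n)))"
    and TE: "\<And>p m n. TE p m n = W p m n - (\<Sum>q\<in>UNIV. YE q n * G p q m + Y q * Q p q m n)"
    and BD: "\<And>p m n. BD p m n = - (\<Sum>r\<in>UNIV. \<Sum>s\<in>UNIV. B m s * G r s p * B r n)"
    and BE: "\<And>q m n. BE q m n = - (\<Sum>r\<in>UNIV. \<Sum>s\<in>UNIV. B m s * H r s q * B r n)"
    and LD: "\<And>p. LD p = (\<Sum>m\<in>UNIV. \<Sum>n\<in>UNIV. BD p m n * U m n + B m n * W p m n)"
    and LE: "\<And>j. LE j = (\<Sum>m\<in>UNIV. \<Sum>n\<in>UNIV. BE j m n * U m n + B m n * W' m j n)"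
    and U: "\<And>p q. U p q = (\<Sum>m\<in>UNIV. \<Sum>n\<in>UNIV. BE q m n * G m n p + B m n * Q p q m n)"
  shows "(\<Sum>m\<in>UNIV. \<Sum>n\<in>UNIV. B m n * ((\<Sum>p\<in>UNIV. XE p n * T p m + X p * TE p m n)
        + (\<Sum>j\<in>UNIV. YE j n * U m j + Y j * W' m j n))) =
    (\<Sum>i\<in>UNIV. \<Sum>j\<in>UNIV. \<Sum>k\<in>UNIV. \<Sum>l\<in>UNIV. B i j * B k l * T i k * T' j l)
    + (\<Sum>i\<in>UNIV. \<Sum>j\<in>UNIV. \<Sum>k\<in>UNIV. \<Sum>l\<in>UNIV. B i j * B k l * U i l * U k j)
    + (\<Sum>p\<in>UNIV. X p * LD p) + (\<Sum>j\<in>UNIV. Y j * LE j)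
    - (\<Sum>p\<in>UNIV. \<Sum>q\<in>UNIV. X p * Y q * U p q)"
proof -
  note flat = sum_distrib_left sum_distrib_right sum.cartesian_product sum_negf[symmetric]
  \<comment> \<open>Splits the antiholomorphic derivative of the gradient into its Hessian part
    \<open>YU\<close> and its Christoffel part \<open>YH\<close>.\<close>
  define YU where "YU q n = (\<Sum>r\<in>UNIV. B r q * U r n)" for q n
  define YH where "YH q n = (\<Sum>r\<in>UNIV. B r q * (\<Sum>s\<in>UNIV. Y s * H r s n))" for q n
  have YE': "YE q n = YU q n - YH q n" for q n
    by (simp add: YE YU_def YH_def algebra_simps sum_subtractf)
  have TT: "(\<Sum>m\<in>UNIV. \<Sum>n\<in>UNIV. B m n * (\<Sum>p\<in>UNIV. XE p n * T p m)) =
      (\<Sum>i\<in>UNIV. \<Sum>j\<in>UNIV. \<Sum>k\<in>UNIV. \<Sum>l\<in>UNIV. B i j * B k l * T i k * T' j l)"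
    unfolding XE flat
    by (rule sum.reindex_bij_witness[of _ "\<lambda>(p,j,m,n). (m,n,p,j)" "\<lambda>(m,n,p,j). (p,j,m,n)"]) auto
  have UU: "(\<Sum>m\<in>UNIV. \<Sum>n\<in>UNIV. B m n * (\<Sum>j\<in>UNIV. YU j n * U m j)) =
      (\<Sum>i\<in>UNIV. \<Sum>j\<in>UNIV. \<Sum>k\<in>UNIV. \<Sum>l\<in>UNIV. B i j * B k l * U i l * U k j)"
    unfolding YU_def flat
    by (rule sum.reindex_bij_witness[of _ "\<lambda>(m,n,r,j). (m,n,j,r)" "\<lambda>(m,n,j,r). (m,n,r,j)"]) auto
  \<comment> \<open>The bijections only rename indices, after \<open>G\<close> or \<open>H\<close>
    has exchanged two of them where necessary. \<open>I1\<close> and \<open>I3\<close> supply the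
    derivatives of the inverse metric in \<open>LD\<close> and \<open>LE\<close>; \<open>I2\<close>
    and \<open>I4\<close> together rebuild \<open>U\<close>, which here is the Ricci
    contribution.\<close>
  have I1: "(\<Sum>m\<in>UNIV. \<Sum>n\<in>UNIV. B m n * (\<Sum>p\<in>UNIV. X p * (\<Sum>q\<in>UNIV. YU q n * G p q m))) =
      - (\<Sum>p\<in>UNIV. X p * (\<Sum>m\<in>UNIV. \<Sum>n\<in>UNIV. BD p m n * U m n))"
    unfolding YU_def BD flat
    by (rule sum.reindex_bij_witness[of _ "\<lambda>(p,r,n,m,q). (m,n,p,q,r)" "\<lambda>(m,n,p,q,r). (p,r,n,m,q)"])
      (auto simp: G)
  have I2: "(\<Sum>m\<in>UNIV. \<Sum>n\<in>UNIV. B m n * (\<Sum>p\<in>UNIV. X p * (\<Sum>q\<in>UNIV. YH q n * G p q m))) =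
      - (\<Sum>p\<in>UNIV. \<Sum>q\<in>UNIV. X p * Y q * (\<Sum>m\<in>UNIV. \<Sum>n\<in>UNIV. BE q m n * G m n p))"
    unfolding YH_def BE flat
    by (rule sum.reindex_bij_witness[of _ "\<lambda>(p,s,m,q,r,n). (m,n,p,q,r,s)" "\<lambda>(m,n,p,q,r,s). (p,s,m,q,r,n)"])
      (auto simp: G H)
  have I3: "(\<Sum>m\<in>UNIV. \<Sum>n\<in>UNIV. B m n * (\<Sum>j\<in>UNIV. YH j n * U m j)) =
      - (\<Sum>j\<in>UNIV. Y j * (\<Sum>m\<in>UNIV. \<Sum>n\<in>UNIV. BE j m n * U m n))"
    unfolding YH_def BE flat
    by (rule sum.reindex_bij_witness[of _ "\<lambda>(s,m,j,r,n). (m,n,j,r,s)" "\<lambda>(m,n,j,r,s). (s,m,j,r,n)"])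
      (auto simp: H)
  have I4: "(\<Sum>m\<in>UNIV. \<Sum>n\<in>UNIV. B m n * (\<Sum>p\<in>UNIV. X p * (\<Sum>q\<in>UNIV. Y q * Q p q m n))) =
      (\<Sum>p\<in>UNIV. \<Sum>q\<in>UNIV. X p * Y q * (\<Sum>m\<in>UNIV. \<Sum>n\<in>UNIV. B m n * Q p q m n))"
    unfolding flat
    by (rule sum.reindex_bij_witness[of _ "\<lambda>(p,q,m,n). (m,n,p,q)" "\<lambda>(m,n,p,q). (p,q,m,n)"]) auto
  have I5: "(\<Sum>m\<in>UNIV. \<Sum>n\<in>UNIV. B m n * (\<Sum>p\<in>UNIV. X p * W p m n)) =
      (\<Sum>p\<in>UNIV. X p * (\<Sum>m\<in>UNIV. \<Sum>n\<in>UNIV. B m n * W p m n))" for X W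
    unfolding flat
    by (rule sum.reindex_bij_witness[of _ "\<lambda>(p,m,n). (m,n,p)" "\<lambda>(m,n,p). (p,m,n)"]) auto
  have main: "(\<Sum>m\<in>UNIV. \<Sum>n\<in>UNIV. B m n * ((\<Sum>p\<in>UNIV. XE p n * T p m + X p * TE p m n)
        + (\<Sum>j\<in>UNIV. YE j n * U m j + Y j * W' m j n))) =
    (\<Sum>m\<in>UNIV. \<Sum>n\<in>UNIV. B m n * (\<Sum>p\<in>UNIV. XE p n * T p m))
    + (\<Sum>m\<in>UNIV. \<Sum>n\<in>UNIV. B m n * (\<Sum>p\<in>UNIV. X p * W p m n))
    - (\<Sum>m\<in>UNIV. \<Sum>n\<in>UNIV. B m n * (\<Sum>p\<in>UNIV. X p * (\<Sum>q\<in>UNIV. YU q n * G p q m)))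
    + (\<Sum>m\<in>UNIV. \<Sum>n\<in>UNIV. B m n * (\<Sum>p\<in>UNIV. X p * (\<Sum>q\<in>UNIV. YH q n * G p q m)))
    - (\<Sum>m\<in>UNIV. \<Sum>n\<in>UNIV. B m n * (\<Sum>p\<in>UNIV. X p * (\<Sum>q\<in>UNIV. Y q * Q p q m n)))
    + (\<Sum>m\<in>UNIV. \<Sum>n\<in>UNIV. B m n * (\<Sum>j\<in>UNIV. YU j n * U m j))
    - (\<Sum>m\<in>UNIV. \<Sum>n\<in>UNIV. B m n * (\<Sum>j\<in>UNIV. YH j n * U m j))
    + (\<Sum>m\<in>UNIV. \<Sum>n\<in>UNIV. B m n * (\<Sum>j\<in>UNIV. Y j * W' m j n))"
    unfolding TE YE' sum.distrib sum_subtractf left_diff_distrib right_diff_distrib distrib_left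
    by simp
  have J1: "(\<Sum>p\<in>UNIV. X p * LD p) = (\<Sum>p\<in>UNIV. X p * (\<Sum>m\<in>UNIV. \<Sum>n\<in>UNIV. BD p m n * U m n)) +
      (\<Sum>p\<in>UNIV. X p * (\<Sum>m\<in>UNIV. \<Sum>n\<in>UNIV. B m n * W p m n))"
    unfolding LD sum.distrib distrib_left ..
  have J2: "(\<Sum>j\<in>UNIV. Y j * LE j) = (\<Sum>j\<in>UNIV. Y j * (\<Sum>m\<in>UNIV. \<Sum>n\<in>UNIV. BE j m n * U m n)) +
      (\<Sum>j\<in>UNIV. Y j * (\<Sum>m\<in>UNIV. \<Sum>n\<in>UNIV. B m n * W' m j n))"
    unfolding LE sum.distrib distrib_left ..
  have J3: "(\<Sum>p\<in>UNIV. \<Sum>q\<in>UNIV. X p * Y q * U p q) =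
      (\<Sum>p\<in>UNIV. \<Sum>q\<in>UNIV. X p * Y q * (\<Sum>m\<in>UNIV. \<Sum>n\<in>UNIV. BE q m n * G m n p)) +
      (\<Sum>p\<in>UNIV. \<Sum>q\<in>UNIV. X p * Y q * (\<Sum>m\<in>UNIV. \<Sum>n\<in>UNIV. B m n * Q p q m n))"
    unfolding U sum.distrib distrib_left ..
  show ?thesis
    unfolding main TT UU I1 I2 I3 I4 I5[of X W] I5[of Y "\<lambda>j m n. W' m j n"] J1 J2 J3 by simp
qed

section \<open>The metric, its inverse and its log determinant\<close>

locale kaehler_potential =
  fixes \<Omega> :: "(complex^'n::finite) set" and f :: "complex^'n \<Rightarrow> real"
  assumes open_dom: "open \<Omega>" and smooth_f: "smooth_on f \<Omega>"
    and pos_def: "z \<in> \<Omega> \<Longrightarrow> pos_def_hermitian (complex_hessian f z)"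
begin

abbreviation "D \<equiv> wirtinger \<i>"
abbreviation "E \<equiv> wirtinger (- \<i>)"

definition F :: "'n \<Rightarrow> 'n \<Rightarrow> complex^'n \<Rightarrow> complex" where
  "F i j z = complex_hessian f z $ i $ j"

definition B :: "'n \<Rightarrow> 'n \<Rightarrow> complex^'n \<Rightarrow> complex" where
  "B i j z = inverse_metric f z $ i $ j"

definition V :: "complex^'n \<Rightarrow> complex" where
  "V = real_to_complex_fun (log_det_metric f)"

lemma F_eq: "F i j = D i (E j (real_to_complex_fun f))"
  by (simp add: fun_eq_iff F_def complex_hessian_def d_z_eq_wirtinger d_zbar_eq_wirtinger)

lemma B_eq: "B i j z = matrix_inv (complex_hessian f z) $ j $ i"
  by (simp add: B_def inverse_metric_def transpose_def)

lemma smooth_on_potential: "smooth_on (real_to_complex_fun f) \<Omega>"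
  unfolding real_to_complex_fun_def
  by (rule smooth_on_bounded_linear[OF bounded_linear_of_real open_dom smooth_f])

lemma smooth_on_F: "smooth_on (F i j) \<Omega>"
  unfolding F_eq by (intro smooth_on_wirtinger open_dom smooth_on_potential)

lemma F_hermitian: "z \<in> \<Omega> \<Longrightarrow> cnj (F i j z) = F j i z"
  unfolding F_def by (rule pos_def_hermitianD(1)[OF pos_def])

lemma det_pos: "z \<in> \<Omega> \<Longrightarrow> 0 < det_metric f z"
  unfolding det_metric_def by (intro pos_def_hermitian_det_pos pos_def)

lemma det_eq: "z \<in> \<Omega> \<Longrightarrow> det (complex_hessian f z) = of_real (det_metric f z)"
  using det_hermitian_real[of "complex_hessian f z"] pos_def_hermitianD(1)[OF pos_def]
  by (simp add: det_metric_def complex_eq_iff)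

lemma det_nz: "z \<in> \<Omega> \<Longrightarrow> det (complex_hessian f z) \<noteq> 0"
  using det_pos by (fastforce simp: det_eq)

lemma B_F_inverse:
  assumes "z \<in> \<Omega>"
  shows "(\<Sum>q\<in>UNIV. B i q z * F p q z) = (if p = i then 1 else 0)"
    and "(\<Sum>p\<in>UNIV. F p q z * B p j z) = (if j = q then 1 else 0)"
proof -
  show "(\<Sum>q\<in>UNIV. B i q z * F p q z) = (if p = i then 1 else 0)"
    unfolding B_eq F_def invertible_matrix_inv(2)[OF det_nz[OF assms], symmetric]
    by (intro sum.cong refl mult.commute)
  show "(\<Sum>p\<in>UNIV. F p q z * B p j z) = (if j = q then 1 else 0)"
    unfolding B_eq F_def invertible_matrix_inv(1)[OF det_nz[OF assms], symmetric]
    by (intro sum.cong refl mult.commute)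
qed

lemma smooth_on_det_hessian: "smooth_on (\<lambda>z. det (complex_hessian f z)) \<Omega>"
  by (intro smooth_on_det open_dom smooth_on_F[unfolded F_def[abs_def]])

lemma smooth_on_B: "smooth_on (B i j) \<Omega>"
proof (rule smooth_on_cong[OF open_dom])
  show "smooth_on (\<lambda>z. det (\<chi> k l. if l = j then (if k = i then 1 else 0) else complex_hessian f z $ k $ l)
      * inverse (det (complex_hessian f z))) \<Omega>"
  proof (intro smooth_on_mult smooth_on_inverse open_dom smooth_on_det smooth_on_det_hessian det_nz)
    fix k l
    have "smooth_on (\<lambda>z. complex_hessian f z $ k $ l) \<Omega>"
      using smooth_on_F[of k l] by (simp add: F_def[abs_def])
    then show "smooth_on (\<lambda>z. (\<chi> k l. if l = j then (if k = i then 1 else 0) else complex_hessian f z $ k $ l) $ k $ l) \<Omega>"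
      by (cases "l = j") (simp_all add: smooth_on_const open_dom)
  qed (rule smooth_on_F[unfolded F_def[abs_def]])
qed (simp add: B_eq matrix_inv_cramer[OF det_nz] divide_inverse)

text \<open>On the positive axis the real logarithm agrees with the holomorphic branch
  \<open>Ln\<close>, so smoothness and the chain rule for \<open>V\<close> come from holomorphic
  composition.\<close>

lemma V_eq: "z \<in> \<Omega> \<Longrightarrow> V z = Ln (det (complex_hessian f z))"
  using det_pos[of z] by (simp add: V_def real_to_complex_fun_def log_det_metric_def det_eq Ln_of_real)

lemma det_not_nonpos: "z \<in> \<Omega> \<Longrightarrow> det (complex_hessian f z) \<notin> \<real>\<^sub>\<le>\<^sub>0"
  using det_pos[of z] by (simp add: det_eq)

lemma smooth_on_Ln_det: "smooth_on (\<lambda>z. Ln (det (complex_hessian f z))) \<Omega>"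
  using det_not_nonpos
  by (intro smooth_on_holomorphic_compose[OF open_dom _ smooth_on_det_hessian, of "- \<real>\<^sub>\<le>\<^sub>0" Ln])
    (auto intro: holomorphic_on_Ln simp: open_Compl)

lemma smooth_on_V: "smooth_on V \<Omega>"
  by (rule smooth_on_cong[OF open_dom smooth_on_Ln_det]) (simp add: V_eq)

lemmas diff_intros = smooth_on_differentiable[where X = \<Omega>]

text \<open>Jacobi's formula: the logarithmic derivative of a determinant is the trace of the
  inverse times the derivative.\<close>

lemma wirtinger_V:
  assumes z: "z \<in> \<Omega>"
  shows "wirtinger c i V z = (\<Sum>m\<in>UNIV. \<Sum>n\<in>UNIV. B m n z * wirtinger c i (F m n) z)"
proof -
  let ?H = "complex_hessian f"
  have "wirtinger c i V z = wirtinger c i (\<lambda>z. Ln (det (?H z))) z"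
    by (intro wirtinger_smooth_cong[OF open_dom smooth_on_V V_eq z])
  also have "\<dots> = inverse (det (?H z)) * wirtinger c i (\<lambda>z. det (?H z)) z"
    using det_not_nonpos[OF z] has_field_derivative_Ln z
    by (intro wirtinger_compose diff_intros smooth_on_det_hessian) (simp_all add: field_simps)
  also have "wirtinger c i (\<lambda>z. det (?H z)) z = det (?H z) *
      (\<Sum>k\<in>UNIV. \<Sum>l\<in>UNIV. matrix_inv (?H z) $ l $ k * wirtinger c i (\<lambda>z. ?H z $ k $ l) z)"
    using smooth_on_F z invertible_matrix_inv(1)[OF det_nz[OF z]]
    by (intro wirtinger_det_inverse diff_intros) (simp_all add: F_def[abs_def])
  finally show ?thesis
    using det_nz[OF z] by (simp add: B_eq F_def[abs_def])
qed

text \<open>Differentiate the constant contraction of \<open>B\<close> with \<open>F\<close> and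
  multiply by \<open>B\<close> to solve for the derivative of \<open>B\<close>.\<close>

lemma wirtinger_B:
  assumes z: "z \<in> \<Omega>"
  shows "wirtinger c m (B i j) z = - (\<Sum>p\<in>UNIV. \<Sum>q\<in>UNIV. B i q z * wirtinger c m (F p q) z * B p j z)"
proof -
  have d: "B i j differentiable at z" "F i j differentiable at z" for i j
    using z by (auto intro: diff_intros smooth_on_B smooth_on_F)
  have 0: "(\<Sum>q\<in>UNIV. wirtinger c m (B i q) z * F p q z) + (\<Sum>q\<in>UNIV. B i q z * wirtinger c m (F p q) z) = 0" for p
  proof -
    have "wirtinger c m (\<lambda>z. \<Sum>q\<in>UNIV. B i q z * F p q z) z = wirtinger c m (\<lambda>z. if p = i then 1 else 0) z"
      using d z by (intro wirtinger_cong[OF open_dom z] B_F_inverse differentiable_sum differentiable_mult) auto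
    also have "\<dots> = 0" by (rule wirtinger_const)
    finally show ?thesis
      using d by (simp add: wirtinger_sum wirtinger_mult differentiable_mult sum.distrib)
  qed
  have "wirtinger c m (B i j) z = (\<Sum>q\<in>UNIV. wirtinger c m (B i q) z * (\<Sum>p\<in>UNIV. F p q z * B p j z))"
    by (simp add: B_F_inverse[OF z] mult_delta_right)
  also have "\<dots> = (\<Sum>p\<in>UNIV. (\<Sum>q\<in>UNIV. wirtinger c m (B i q) z * F p q z) * B p j z)"
    unfolding sum_distrib_left sum_distrib_right by (subst sum.swap) (simp add: mult.assoc)
  also have "\<dots> = (\<Sum>p\<in>UNIV. - (\<Sum>q\<in>UNIV. B i q z * wirtinger c m (F p q) z) * B p j z)"
    by (simp add: 0[folded eq_neg_iff_add_eq_0])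
  finally show ?thesis
    by (simp add: sum_distrib_right sum_negf)
qed

text \<open>Conjugating the inverse relation makes \<open>cnj B\<close> a left inverse of
  \<open>F\<close>, while the transpose of \<open>B\<close> is a right inverse; the two
  coincide.\<close>

lemma B_hermitian:
  assumes z: "z \<in> \<Omega>"
  shows "cnj (B i j z) = B j i z"
proof -
  have 1: "(\<Sum>q\<in>UNIV. cnj (B i q z) * F q p z) = (if p = i then 1 else 0)" for p i
    using arg_cong[OF B_F_inverse(1)[OF z, of i p], of cnj] by (simp add: F_hermitian[OF z] if_distrib[of cnj])
  have "cnj (B i j z) = (\<Sum>q\<in>UNIV. cnj (B i q z) * (if q = j then 1 else 0))"
    by (simp add: mult_delta_right)
  also have "\<dots> = (\<Sum>q\<in>UNIV. cnj (B i q z) * (\<Sum>p\<in>UNIV. B j p z * F q p z))"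
    by (simp add: B_F_inverse[OF z])
  also have "\<dots> = (\<Sum>p\<in>UNIV. (\<Sum>q\<in>UNIV. cnj (B i q z) * F q p z) * B j p z)"
    unfolding sum_distrib_left sum_distrib_right by (subst sum.swap) (simp add: mult_ac)
  also have "\<dots> = B j i z"
    by (simp add: 1 mult_delta_left)
  finally show ?thesis .
qed

text \<open>Substituting \<open>v = F w\<close> turns the form of the inverse metric at
  \<open>v\<close> into the form of the metric at the conjugate of \<open>w\<close>.\<close>

lemma B_psd:
  assumes z: "z \<in> \<Omega>"
  shows "hermitian_psd (\<lambda>i j. B i j z)"
  unfolding hermitian_psd_def
proof (intro conjI allI)
  fix v :: "'n \<Rightarrow> complex"
  define w where "w j = (\<Sum>i\<in>UNIV. B i j z * v i)" for j
  have v: "v k = (\<Sum>j\<in>UNIV. F k j z * w j)" for k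
  proof -
    have "(\<Sum>j\<in>UNIV. F k j z * w j) = (\<Sum>i\<in>UNIV. (\<Sum>j\<in>UNIV. B i j z * F k j z) * v i)"
      unfolding w_def sum_distrib_left sum_distrib_right by (subst sum.swap) (simp add: mult_ac)
    then show ?thesis by (simp add: B_F_inverse[OF z] mult_delta_left)
  qed
  have "(\<Sum>i\<in>UNIV. \<Sum>j\<in>UNIV. B i j z * v i * cnj (v j)) = (\<Sum>j\<in>UNIV. w j * cnj (v j))"
    unfolding w_def sum_distrib_right by (subst sum.swap) simp
  also have "\<dots> = (\<Sum>k\<in>UNIV. \<Sum>j\<in>UNIV. complex_hessian f z $ k $ j * (\<chi> i. cnj (w i)) $ k * cnj ((\<chi> i. cnj (w i)) $ j))"
    unfolding v cnj_sum sum_distrib_left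
    by (subst sum.swap) (simp add: F_hermitian[OF z] mult_ac F_def[symmetric])
  also have "0 \<le> Re \<dots>"
    using pos_def_hermitianD(2)[OF pos_def[OF z], of "\<chi> i. cnj (w i)"]
    by (cases "(\<chi> i. cnj (w i)) = 0") (auto simp: vec_eq_iff)
  finally show "0 \<le> Re (\<Sum>i\<in>UNIV. \<Sum>j\<in>UNIV. B i j z * v i * cnj (v j))" .
qed (simp add: B_hermitian[OF z])

lemma cnj_V: "cnj (V z) = V z"
  by (simp add: V_def real_to_complex_fun_def)

text \<open>The Kaehler condition in coordinates. It holds because the metric comes from a
  potential, whose derivatives commute.\<close>

lemma F_commute: "z \<in> \<Omega> \<Longrightarrow> D m (F p q) z = D p (F m q) z"
  and F_commute': "z \<in> \<Omega> \<Longrightarrow> E n (F p q) z = E q (F p n) z"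
proof -
  assume z: "z \<in> \<Omega>"
  show "D m (F p q) z = D p (F m q) z"
    unfolding F_eq by (intro wirtinger_commute[OF open_dom] smooth_on_wirtinger open_dom smooth_on_potential z)
  have sE: "smooth_on (E j (real_to_complex_fun f)) \<Omega>" for j
    by (intro smooth_on_wirtinger open_dom smooth_on_potential)
  show "E n (F p q) z = E q (F p n) z"
    unfolding F_eq
    using wirtinger_commute[OF open_dom sE z] wirtinger_commute_inner[OF open_dom smooth_on_potential z] by metis
qed

section \<open>Gradients and covariant derivatives of V\<close>

definition U :: "'n \<Rightarrow> 'n \<Rightarrow> complex^'n \<Rightarrow> complex" where
  "U m n = D m (E n V)"

text \<open>\<open>Y\<close> and the conjugate quantity \<open>X\<close> are the components of the
  gradient of \<open>V\<close>, that is, its first derivatives with the index raised.\<close>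

definition Y :: "'n \<Rightarrow> complex^'n \<Rightarrow> complex" where
  "Y j z = (\<Sum>i\<in>UNIV. B i j z * D i V z)"

definition X :: "'n \<Rightarrow> complex^'n \<Rightarrow> complex" where
  "X p z = (\<Sum>j\<in>UNIV. B p j z * E j V z)"

text \<open>The covariant derivative \<open>V\<^bsub>,pm\<^esub>\<close>; the Christoffel term is contracted with the gradient.\<close>

definition T :: "'n \<Rightarrow> 'n \<Rightarrow> complex^'n \<Rightarrow> complex" where
  "T p m z = D m (D p V) z - (\<Sum>q\<in>UNIV. Y q z * D m (F p q) z)"

text \<open>The complex-valued form of \<open>Psi\<close>, as \<open>lap_V\<close> is that of
  \<open>- scal_curv\<close>; Wirtinger rules apply to these, and realness is shown
  separately.\<close>

definition grad_sq :: "complex^'n \<Rightarrow> complex" where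
  "grad_sq z = (\<Sum>j\<in>UNIV. Y j z * E j V z)"

definition lap_V :: "complex^'n \<Rightarrow> complex" where
  "lap_V z = (\<Sum>m\<in>UNIV. \<Sum>n\<in>UNIV. B m n z * U m n z)"

lemma smooth_on_Y: "smooth_on (Y j) \<Omega>"
  unfolding Y_def[abs_def]
  by (intro smooth_on_sum smooth_on_mult smooth_on_B smooth_on_wirtinger smooth_on_V open_dom)

lemma smooth_on_X: "smooth_on (X p) \<Omega>"
  unfolding X_def[abs_def]
  by (intro smooth_on_sum smooth_on_mult smooth_on_B smooth_on_wirtinger smooth_on_V open_dom)

lemma smooth_on_U: "smooth_on (U m n) \<Omega>"
  unfolding U_def by (intro smooth_on_wirtinger smooth_on_V open_dom)

lemma smooth_on_T: "smooth_on (T p m) \<Omega>"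
  unfolding T_def[abs_def]
  by (intro smooth_on_sum smooth_on_mult smooth_on_diff smooth_on_wirtinger smooth_on_V smooth_on_F smooth_on_Y open_dom)

lemma smooth_on_grad_sq: "smooth_on grad_sq \<Omega>"
  unfolding grad_sq_def[abs_def]
  by (intro smooth_on_sum smooth_on_mult smooth_on_wirtinger smooth_on_V smooth_on_Y open_dom)

lemma smooth_on_lap_V: "smooth_on lap_V \<Omega>"
  unfolding lap_V_def[abs_def]
  by (intro smooth_on_sum smooth_on_mult smooth_on_U smooth_on_B open_dom)

lemma wirtinger_cnj_cong:
  assumes "smooth_on g \<Omega>" "z \<in> \<Omega>" "\<And>z. z \<in> \<Omega> \<Longrightarrow> h z = cnj (g z)"
  shows "wirtinger c i h z = cnj (wirtinger (cnj c) i g z)"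
proof -
  have "wirtinger c i h z = wirtinger c i (\<lambda>z. cnj (g z)) z"
    using assms smooth_on_bounded_linear[OF bounded_linear_cnj open_dom assms(1)]
    by (intro wirtinger_smooth_cong[OF open_dom, symmetric]) auto
  then show ?thesis
    using wirtinger_cnj[OF smooth_on_differentiable[OF assms(1,2)]] by simp
qed

lemma E_V: "z \<in> \<Omega> \<Longrightarrow> E j V z = cnj (D j V z)"
  using wirtinger_cnj_cong[OF smooth_on_V, of z V "- \<i>" j] by (simp add: cnj_V)

lemma X_cnj: "z \<in> \<Omega> \<Longrightarrow> X p z = cnj (Y p z)"
  by (simp add: X_def Y_def E_V B_hermitian)

lemma U_eq: "z \<in> \<Omega> \<Longrightarrow> U m n z = E n (D m V) z"
  unfolding U_def by (rule wirtinger_commute[OF open_dom smooth_on_V])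

lemma U_hermitian: "z \<in> \<Omega> \<Longrightarrow> cnj (U m n z) = U n m z"
proof -
  assume z: "z \<in> \<Omega>"
  have "D m (E n V) z = cnj (E m (D n V) z)"
    using wirtinger_cnj_cong[OF smooth_on_wirtinger[OF open_dom smooth_on_V] z E_V, of \<i>] by simp
  then show ?thesis
    by (simp add: U_def wirtinger_commute[OF open_dom smooth_on_V z])
qed

lemma grad_sq_eq: "grad_sq z = (\<Sum>i\<in>UNIV. \<Sum>j\<in>UNIV. B i j z * D i V z * E j V z)"
  unfolding grad_sq_def Y_def sum_distrib_right by (rule sum.swap)

text \<open>The derivative of \<open>B\<close> turns into a correction contracted with
  \<open>Y\<close>. In the holomorphic direction the bracket is the covariant Hessian
  \<open>T\<close>; in the antiholomorphic one it is \<open>U\<close> with a Christoffel term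
  remaining.\<close>

lemma wirtinger_Y:
  assumes z: "z \<in> \<Omega>"
  shows "wirtinger c m (Y j) z = (\<Sum>p\<in>UNIV. B p j z *
    (wirtinger c m (D p V) z - (\<Sum>q\<in>UNIV. Y q z * wirtinger c m (F p q) z)))"
proof -
  have d: "B i j differentiable at z" "D i V differentiable at z" for i j
    using z by (auto intro!: diff_intros smooth_on_B smooth_on_wirtinger smooth_on_V open_dom)
  have "wirtinger c m (Y j) z =
      (\<Sum>i\<in>UNIV. wirtinger c m (B i j) z * D i V z) + (\<Sum>i\<in>UNIV. B i j z * wirtinger c m (D i V) z)"
    unfolding Y_def[abs_def] using d
    by (simp add: wirtinger_sum wirtinger_mult differentiable_mult sum.distrib)
  also have "(\<Sum>i\<in>UNIV. wirtinger c m (B i j) z * D i V z) =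
      - (\<Sum>p\<in>UNIV. B p j z * (\<Sum>q\<in>UNIV. Y q z * wirtinger c m (F p q) z))"
    unfolding wirtinger_B[OF z] Y_def sum_distrib_left sum_distrib_right sum.cartesian_product sum_negf[symmetric]
    by (rule sum.reindex_bij_witness[of _ "\<lambda>(p,q,i). (i,p,q)" "\<lambda>(i,p,q). (p,q,i)"]) auto
  finally show ?thesis
    by (simp add: right_diff_distrib sum_subtractf)
qed

lemma D_Y: "z \<in> \<Omega> \<Longrightarrow> D m (Y j) z = (\<Sum>p\<in>UNIV. B p j z * T p m z)"
  by (simp add: wirtinger_Y T_def)

lemma E_Y: "z \<in> \<Omega> \<Longrightarrow> E n (Y q) z =
    (\<Sum>r\<in>UNIV. B r q z * (U r n z - (\<Sum>s\<in>UNIV. Y s z * E n (F r s) z)))"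
  by (simp add: wirtinger_Y U_eq)

lemma E_X: "z \<in> \<Omega> \<Longrightarrow> E n (X p) z = (\<Sum>j\<in>UNIV. B p j z * cnj (T j n z))"
  using wirtinger_cnj_cong[OF smooth_on_Y, of z "X p" p "- \<i>" n]
  by (simp add: X_cnj D_Y B_hermitian)

text \<open>Compatibility with the metric: all first derivatives of the metric are absorbed in
  \<open>T\<close>.\<close>

lemma D_grad_sq:
  assumes z: "z \<in> \<Omega>"
  shows "D m grad_sq z = (\<Sum>p\<in>UNIV. X p z * T p m z) + (\<Sum>j\<in>UNIV. Y j z * U m j z)"
proof -
  have d: "Y j differentiable at z" "E j V differentiable at z" for j
    using z by (auto intro!: diff_intros smooth_on_Y smooth_on_wirtinger smooth_on_V open_dom)
  have "D m grad_sq z = (\<Sum>j\<in>UNIV. D m (Y j) z * E j V z) + (\<Sum>j\<in>UNIV. Y j z * U m j z)"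
    unfolding grad_sq_def[abs_def] U_def using d
    by (simp add: wirtinger_sum wirtinger_mult differentiable_mult sum.distrib)
  also have "(\<Sum>j\<in>UNIV. D m (Y j) z * E j V z) = (\<Sum>p\<in>UNIV. X p z * T p m z)"
    unfolding D_Y[OF z] X_def sum_distrib_right by (subst sum.swap) (simp add: mult_ac)
  finally show ?thesis .
qed

lemma bochner:
  assumes z: "z \<in> \<Omega>"
  shows "(\<Sum>m\<in>UNIV. \<Sum>n\<in>UNIV. B m n z * D m (E n grad_sq) z) =
    (\<Sum>i\<in>UNIV. \<Sum>j\<in>UNIV. \<Sum>k\<in>UNIV. \<Sum>l\<in>UNIV. B i j z * B k l z * T i k z * cnj (T j l z))
    + (\<Sum>i\<in>UNIV. \<Sum>j\<in>UNIV. \<Sum>k\<in>UNIV. \<Sum>l\<in>UNIV. B i j z * B k l z * U i l z * U k j z)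
    + (\<Sum>p\<in>UNIV. X p z * D p lap_V z) + (\<Sum>j\<in>UNIV. Y j z * E j lap_V z)
    - (\<Sum>p\<in>UNIV. \<Sum>q\<in>UNIV. X p z * Y q z * U p q z)"
proof -
  have d: "B i j differentiable at z" "X i differentiable at z" "Y i differentiable at z"
    "T i j differentiable at z" "U i j differentiable at z" "D i (F j k) differentiable at z"
    "D i (D j V) differentiable at z" for i j k
    using z by (auto intro!: diff_intros smooth_on_B smooth_on_X smooth_on_Y smooth_on_T smooth_on_U smooth_on_F
      smooth_on_wirtinger smooth_on_V open_dom)
  have sm: "smooth_on (D i V) \<Omega>" "smooth_on (E i V) \<Omega>" "smooth_on (D i (F j k)) \<Omega>" for i j k
    by (intro smooth_on_wirtinger smooth_on_V smooth_on_F open_dom)+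
  \<comment> \<open>The order is exchanged so that the closed form of the holomorphic derivative,
    \<open>D_grad_sq\<close>, is what gets differentiated next.\<close>
  have comm: "D m (E n grad_sq) z = E n (D m grad_sq) z" for m n
    by (rule wirtinger_commute[OF open_dom smooth_on_grad_sq z])
  have hess: "E n (D m grad_sq) z = (\<Sum>p\<in>UNIV. E n (X p) z * T p m z + X p z * E n (T p m) z)
      + (\<Sum>j\<in>UNIV. E n (Y j) z * U m j z + Y j z * E n (U m j) z)" for m n
  proof -
    have "E n (D m grad_sq) z = E n (\<lambda>z. (\<Sum>p\<in>UNIV. X p z * T p m z) + (\<Sum>j\<in>UNIV. Y j z * U m j z)) z"
      by (intro wirtinger_smooth_cong[OF open_dom] smooth_on_wirtinger smooth_on_grad_sq D_grad_sq open_dom z)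
    then show ?thesis
      using d by (simp add: wirtinger_add wirtinger_sum wirtinger_mult differentiable_mult differentiable_sum)
  qed
  show ?thesis
    unfolding comm hess
  proof (rule bochner_contraction[where B = "\<lambda>i j. B i j z" and X = "\<lambda>p. X p z" and Y = "\<lambda>p. Y p z"
        and T = "\<lambda>i j. T i j z" and T' = "\<lambda>i j. cnj (T i j z)" and U = "\<lambda>i j. U i j z"
        and G = "\<lambda>p q m. D m (F p q) z" and H = "\<lambda>p q n. E n (F p q) z"
        and W = "\<lambda>p m n. E n (D m (D p V)) z" and W' = "\<lambda>m j n. E n (U m j) z"
        and Q = "\<lambda>p q m n. E n (D m (F p q)) z" and BD = "\<lambda>p m n. D p (B m n) z"
        and BE = "\<lambda>q m n. E q (B m n) z" and XE = "\<lambda>p n. E n (X p) z" and YE = "\<lambda>q n. E n (Y q) z"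
        and TE = "\<lambda>p m n. E n (T p m) z" and LD = "\<lambda>p. D p lap_V z" and LE = "\<lambda>j. E j lap_V z"])
    fix p q m n j
    show "D m (F p q) z = D p (F m q) z" "E n (F p q) z = E q (F p n) z"
      using F_commute F_commute' z by blast+
    show "E n (X p) z = (\<Sum>j\<in>UNIV. B p j z * cnj (T j n z))"
      by (rule E_X[OF z])
    show "E n (Y q) z = (\<Sum>r\<in>UNIV. B r q z * (U r n z - (\<Sum>s\<in>UNIV. Y s z * E n (F r s) z)))"
      by (rule E_Y[OF z])
    show "E n (T p m) z = E n (D m (D p V)) z
        - (\<Sum>q\<in>UNIV. E n (Y q) z * D m (F p q) z + Y q z * E n (D m (F p q)) z)"
      unfolding T_def[abs_def] using d
      by (simp add: wirtinger_diff wirtinger_sum wirtinger_mult differentiable_mult differentiable_sum)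
    show "D p (B m n) z = - (\<Sum>r\<in>UNIV. \<Sum>s\<in>UNIV. B m s z * D p (F r s) z * B r n z)"
      "E q (B m n) z = - (\<Sum>r\<in>UNIV. \<Sum>s\<in>UNIV. B m s z * E q (F r s) z * B r n z)"
      by (rule wirtinger_B[OF z])+
    have lap: "wirtinger c p lap_V z = (\<Sum>m\<in>UNIV. \<Sum>n\<in>UNIV. wirtinger c p (B m n) z * U m n z
        + B m n z * wirtinger c p (U m n) z)" for c p
      unfolding lap_V_def[abs_def] using d
      by (simp add: wirtinger_sum wirtinger_mult differentiable_mult differentiable_sum)
    \<comment> \<open>Third derivatives of \<open>V\<close> are brought into one common order, so
      that the derivatives of \<open>U\<close> in \<open>lap_V\<close> match those in the expansion
      of \<open>grad_sq\<close>.\<close>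
    have "D p (U m n) z = E n (D m (D p V)) z" for m n
    proof -
      have "D p (U m n) z = D p (E n (D m V)) z"
        unfolding U_def by (rule wirtinger_commute_inner[OF open_dom smooth_on_V z])
      also have "\<dots> = E n (D p (D m V)) z"
        by (rule wirtinger_commute[OF open_dom sm(1) z])
      also have "\<dots> = E n (D m (D p V)) z"
        by (rule wirtinger_commute_inner[OF open_dom smooth_on_V z])
      finally show ?thesis .
    qed
    then show "D p lap_V z = (\<Sum>m\<in>UNIV. \<Sum>n\<in>UNIV. D p (B m n) z * U m n z + B m n z * E n (D m (D p V)) z)"
      by (simp add: lap)
    have "E j (U m n) z = E n (U m j) z" for m n
    proof -
      have "E j (U m n) z = D m (E j (E n V)) z"
        unfolding U_def by (rule wirtinger_commute[OF open_dom sm(2) z])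
      also have "\<dots> = D m (E n (E j V)) z"
        by (rule wirtinger_commute_inner[OF open_dom smooth_on_V z])
      also have "\<dots> = E n (U m j) z"
        unfolding U_def by (rule wirtinger_commute[OF open_dom sm(2) z])
      finally show ?thesis .
    qed
    then show "E j lap_V z = (\<Sum>m\<in>UNIV. \<Sum>n\<in>UNIV. E j (B m n) z * U m n z + B m n z * E n (U m j) z)"
      by (simp add: lap)
    \<comment> \<open>Fourth derivatives of the potential are symmetric in the two holomorphic and
      in the two antiholomorphic indices; each exchange takes place inside a further
      derivative.\<close>
    have swap: "E q (D p (F m n)) z = E n (D m (F p q)) z" for m n
    proof -
      have "E q (D p (F m n)) z = E q (D m (F p n)) z"
        by (intro wirtinger_smooth_cong[OF open_dom sm(3) F_commute z])
      also have "\<dots> = D m (E q (F p n)) z"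
        by (rule wirtinger_commute[OF open_dom smooth_on_F z])
      also have "\<dots> = D m (E n (F p q)) z"
        by (intro wirtinger_smooth_cong[OF open_dom smooth_on_wirtinger F_commute' z] open_dom smooth_on_F)
      also have "\<dots> = E n (D m (F p q)) z"
        by (rule wirtinger_commute[OF open_dom smooth_on_F z])
      finally show ?thesis .
    qed
    \<comment> \<open>Here curvature enters: Jacobi's formula for the first derivative of
      \<open>V\<close> is differentiated once more.\<close>
    have "U p q z = E q (\<lambda>z. \<Sum>m\<in>UNIV. \<Sum>n\<in>UNIV. B m n z * D p (F m n) z) z"
      unfolding U_eq[OF z] by (intro wirtinger_smooth_cong[OF open_dom sm(1) wirtinger_V z])
    then show "U p q z = (\<Sum>m\<in>UNIV. \<Sum>n\<in>UNIV. E q (B m n) z * D p (F m n) z + B m n z * E n (D m (F p q)) z)"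
      using d by (simp add: wirtinger_sum wirtinger_mult differentiable_mult differentiable_sum swap)
  qed
qed

subsection \<open>The differential inequality\<close>

lemma square_op_eq:
  "square_op f u z = Re (\<Sum>m\<in>UNIV. \<Sum>n\<in>UNIV. B m n z * D m (E n (real_to_complex_fun u)) z)"
  by (simp add: square_op_def B_def complex_hessian_def d_z_eq_wirtinger d_zbar_eq_wirtinger)

lemma grad_inner_eq:
  "grad_inner f u (log_det_metric f) z = (\<Sum>j\<in>UNIV. Y j z * E j (real_to_complex_fun u) z)"
  unfolding grad_inner_def Y_def sum_distrib_right
  by (subst sum.swap) (simp add: B_def V_def d_z_eq_wirtinger d_zbar_eq_wirtinger)

lemma Psi_eq: "Psi f z = Re (grad_sq z)"
  by (simp add: Psi_def grad_norm_sq_def grad_inner_eq grad_sq_def V_def)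

lemma grad_sq_real:
  assumes z: "z \<in> \<Omega>"
  shows "grad_sq z = of_real (Psi f z)"
  using hermitian_contraction_real[of "\<lambda>i j. B i j z" "\<lambda>i j. D i V z * E j V z"]
  by (simp add: Psi_eq grad_sq_eq B_hermitian[OF z] E_V[OF z] mult.assoc mult.commute[of "cnj _"])

lemma Psi_nonneg:
  assumes z: "z \<in> \<Omega>"
  shows "0 \<le> Psi f z"
  using B_psd[OF z, unfolded hermitian_psd_def, THEN conjunct2, rule_format, of "\<lambda>i. D i V z"]
  by (simp only: Psi_eq grad_sq_eq E_V[OF z])

lemma lap_V_real:
  assumes z: "z \<in> \<Omega>"
  shows "lap_V z = - of_real (scal_curv f z)"
  using hermitian_contraction_real[of "\<lambda>i j. B i j z" "\<lambda>i j. U i j z"]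
  by (simp add: scal_curv_def square_op_eq lap_V_def U_def[symmetric] V_def[symmetric]
      B_hermitian[OF z] U_hermitian[OF z])

lemma grad_inner_scal_curv:
  assumes z: "z \<in> \<Omega>"
  shows "grad_inner f (scal_curv f) (log_det_metric f) z = - (\<Sum>j\<in>UNIV. Y j z * E j lap_V z)"
proof -
  have "E j (real_to_complex_fun (scal_curv f)) z = - E j lap_V z" for j
  proof -
    have "E j (real_to_complex_fun (scal_curv f)) z = E j (\<lambda>z. - lap_V z) z"
      by (intro wirtinger_smooth_cong[OF open_dom _ _ z, symmetric] smooth_on_minus smooth_on_lap_V open_dom)
        (simp add: lap_V_real real_to_complex_fun_def)
    then show ?thesis
      using wirtinger_minus[OF diff_intros[OF smooth_on_lap_V z]] by simp
  qed
  then show ?thesis by (simp add: grad_inner_eq sum_negf)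
qed

text \<open>The second gradient term of the Bochner formula is the conjugate of the first because
  \<open>lap_V\<close> is real; their sum is therefore twice a real part.\<close>

lemma grad_inner_scal_curv_cnj:
  assumes z: "z \<in> \<Omega>"
  shows "cnj (grad_inner f (scal_curv f) (log_det_metric f) z) = - (\<Sum>p\<in>UNIV. X p z * D p lap_V z)"
proof -
  have "D p lap_V z = cnj (E p lap_V z)" for p
    using wirtinger_cnj_cong[OF smooth_on_lap_V z, of lap_V \<i>] by (simp add: lap_V_real)
  then show ?thesis
    by (simp add: grad_inner_scal_curv[OF z] X_cnj[OF z])
qed

lemma mixed_hessian_norm_sq_eq:
  "mixed_hessian_norm_sq f (log_det_metric f) z =
    Re (\<Sum>i\<in>UNIV. \<Sum>j\<in>UNIV. \<Sum>k\<in>UNIV. \<Sum>l\<in>UNIV. B i j z * B k l z * U i l z * U k j z)"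
  by (simp add: mixed_hessian_norm_sq_def B_def complex_hessian_def d_z_eq_wirtinger d_zbar_eq_wirtinger U_def V_def)

section \<open>The exponential weight and the Laplacian of P\<close>

definition weight :: "real \<Rightarrow> real \<Rightarrow> complex^'n \<Rightarrow> complex" where
  "weight \<alpha> \<kappa> z = exp (of_real \<kappa> * exp (of_real \<alpha> * V z) + V z / 2)"

text \<open>The logarithmic derivative of \<open>weight\<close> with respect to \<open>V\<close>. As
  both are functions of \<open>V\<close> alone, all their derivatives are multiples of those of
  \<open>V\<close>.\<close>

definition weight' :: "real \<Rightarrow> real \<Rightarrow> complex^'n \<Rightarrow> complex" where
  "weight' \<alpha> \<kappa> z = of_real (\<alpha> * \<kappa>) * exp (of_real \<alpha> * V z) + 1 / 2"

lemma exp_V: "z \<in> \<Omega> \<Longrightarrow> exp (of_real \<alpha> * V z) = of_real (det_metric f z powr \<alpha>)"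
  using det_pos[of z]
  by (simp add: V_def real_to_complex_fun_def log_det_metric_def powr_def flip: of_real_mult exp_of_real)

lemma weight_real:
  "z \<in> \<Omega> \<Longrightarrow> weight \<alpha> \<kappa> z = of_real (exp (\<kappa> * det_metric f z powr \<alpha>) * sqrt (det_metric f z))"
  using exp_V[of z \<alpha>] exp_V[of z "1/2"] det_pos[of z]
  by (simp add: weight_def exp_add powr_half_sqrt exp_of_real flip: of_real_mult)

lemma smooth_on_weight: "smooth_on (weight \<alpha> \<kappa>) \<Omega>"
  unfolding weight_def[abs_def] divide_inverse
  by (intro smooth_on_exp smooth_on_add smooth_on_mult smooth_on_const smooth_on_V open_dom)

lemma smooth_on_weight': "smooth_on (weight' \<alpha> \<kappa>) \<Omega>"
  unfolding weight'_def[abs_def]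
  by (intro smooth_on_exp smooth_on_add smooth_on_mult smooth_on_const smooth_on_V open_dom)

lemma wirtinger_exp_V:
  assumes z: "z \<in> \<Omega>"
  shows "wirtinger c i (\<lambda>z. exp (a * V z)) z = a * exp (a * V z) * wirtinger c i V z"
proof -
  have d: "(\<lambda>z. a * V z) differentiable at z" "V differentiable at z"
    using z by (auto intro!: diff_intros smooth_on_mult smooth_on_const smooth_on_V open_dom)
  have "wirtinger c i (\<lambda>z. exp (a * V z)) z = exp (a * V z) * wirtinger c i (\<lambda>z. a * V z) z"
    by (rule wirtinger_compose[OF d(1) DERIV_exp])
  then show ?thesis using wirtinger_cmult[OF d(2)] by simp
qed

lemma wirtinger_weight:
  assumes z: "z \<in> \<Omega>"
  shows "wirtinger c i (weight \<alpha> \<kappa>) z = weight \<alpha> \<kappa> z * weight' \<alpha> \<kappa> z * wirtinger c i V z"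
proof -
  have d: "(\<lambda>z. exp (a * V z)) differentiable at z" "V differentiable at z" for a
    using z by (auto intro!: diff_intros smooth_on_mult smooth_on_const smooth_on_V smooth_on_exp open_dom)
  have d': "(\<lambda>z. of_real \<kappa> * exp (of_real \<alpha> * V z) + (1 / 2) * V z) differentiable at z"
    using d by (intro differentiable_add differentiable_mult differentiable_const)
  have "weight \<alpha> \<kappa> = (\<lambda>z. exp (of_real \<kappa> * exp (of_real \<alpha> * V z) + (1 / 2) * V z))"
    by (simp add: weight_def[abs_def])
  then have "wirtinger c i (weight \<alpha> \<kappa>) z = weight \<alpha> \<kappa> z *
      wirtinger c i (\<lambda>z. of_real \<kappa> * exp (of_real \<alpha> * V z) + (1 / 2) * V z) z"
    using wirtinger_compose[OF d' DERIV_exp] by simp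
  also have "wirtinger c i (\<lambda>z. of_real \<kappa> * exp (of_real \<alpha> * V z) + (1 / 2) * V z) z =
      weight' \<alpha> \<kappa> z * wirtinger c i V z"
    using d wirtinger_cmult[OF d(2), of c i "1 / 2"] by (subst wirtinger_add)
      (simp_all add: wirtinger_cmult wirtinger_exp_V[OF z] weight'_def differentiable_mult algebra_simps)
  finally show ?thesis by (simp add: mult.assoc)
qed

lemma wirtinger_weight':
  assumes z: "z \<in> \<Omega>"
  shows "wirtinger c i (weight' \<alpha> \<kappa>) z = of_real (\<alpha>\<^sup>2 * \<kappa> * det_metric f z powr \<alpha>) * wirtinger c i V z"
proof -
  have d: "(\<lambda>z. exp (a * V z)) differentiable at z" for a
    using z by (auto intro!: diff_intros smooth_on_mult smooth_on_const smooth_on_V smooth_on_exp open_dom)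
  show ?thesis
    unfolding weight'_def[abs_def] using d
    by (subst wirtinger_add)
      (simp_all add: wirtinger_cmult wirtinger_const wirtinger_exp_V[OF z] exp_V[OF z] differentiable_mult power2_eq_square)
qed

text \<open>Product rule for the weight times \<open>Psi\<close>. Differentiating the weight twice
  gives \<open>h\<^sup>2\<close>, differentiating \<open>weight'\<close> gives
  \<open>\<alpha>\<^sup>2 * \<kappa> * w\<close>; both come with the squared gradient of
  \<open>V\<close>, which is \<open>Psi\<close> again, hence the factor
  \<open>(Psi f z)\<^sup>2\<close>.\<close>

lemma square_P_fun:
  fixes \<alpha> \<kappa> :: real
  assumes z: "z \<in> \<Omega>"
  defines "w \<equiv> det_metric f z powr \<alpha>"
  defines "h \<equiv> \<alpha> * \<kappa> * w + 1 / 2"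
  shows "square_op f (P_fun \<alpha> \<kappa> f) z = exp (\<kappa> * w) * sqrt (det_metric f z) *
    ((h\<^sup>2 + \<alpha>\<^sup>2 * \<kappa> * w) * (Psi f z)\<^sup>2 - h * scal_curv f z * Psi f z
      + 2 * h * Re (\<Sum>m\<in>UNIV. X m z * D m grad_sq z)
      + Re (\<Sum>m\<in>UNIV. \<Sum>n\<in>UNIV. B m n z * D m (E n grad_sq) z))"
proof -
  define G where "G = weight \<alpha> \<kappa> z"
  define e where "e = complex_of_real (\<alpha>\<^sup>2 * \<kappa> * w)"
  have d: "weight \<alpha> \<kappa> differentiable at z" "weight' \<alpha> \<kappa> differentiable at z" "V differentiable at z"
    "grad_sq differentiable at z" "E n V differentiable at z" "E n grad_sq differentiable at z"
    if "z \<in> \<Omega>" for n z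
    using that by (auto intro!: diff_intros smooth_on_weight smooth_on_weight' smooth_on_V smooth_on_grad_sq
      smooth_on_wirtinger open_dom)
  have h: "weight' \<alpha> \<kappa> z = of_real h"
    using z by (simp add: weight'_def exp_V h_def w_def)
  have P: "weight \<alpha> \<kappa> z * grad_sq z = real_to_complex_fun (P_fun \<alpha> \<kappa> f) z" if "z \<in> \<Omega>" for z
    using that by (simp add: real_to_complex_fun_def P_fun_def weight_real grad_sq_real)
  have smP: "smooth_on (\<lambda>z. weight \<alpha> \<kappa> z * grad_sq z) \<Omega>"
    by (intro smooth_on_mult smooth_on_weight smooth_on_grad_sq open_dom)
  have smP': "smooth_on (real_to_complex_fun (P_fun \<alpha> \<kappa> f)) \<Omega>"
    by (rule smooth_on_cong[OF open_dom smP P])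
  have EP: "E n (real_to_complex_fun (P_fun \<alpha> \<kappa> f)) z =
      weight \<alpha> \<kappa> z * (weight' \<alpha> \<kappa> z * E n V z * grad_sq z + E n grad_sq z)" if "z \<in> \<Omega>" for n z
  proof -
    have "E n (real_to_complex_fun (P_fun \<alpha> \<kappa> f)) z = E n (\<lambda>z. weight \<alpha> \<kappa> z * grad_sq z) z"
      by (intro wirtinger_smooth_cong[OF open_dom smP P that, symmetric])
    then show ?thesis
      using d[OF that] by (simp add: wirtinger_mult wirtinger_weight[OF that] algebra_simps)
  qed
  have DEP: "D m (E n (real_to_complex_fun (P_fun \<alpha> \<kappa> f))) z = G *
      (((of_real h)\<^sup>2 + e) * grad_sq z * (D m V z * E n V z) + of_real h * grad_sq z * U m n z
       + of_real h * (D m V z * E n grad_sq z) + of_real h * (E n V z * D m grad_sq z) + D m (E n grad_sq) z)" for m n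
  proof -
    have "D m (E n (real_to_complex_fun (P_fun \<alpha> \<kappa> f))) z =
      D m (\<lambda>z. weight \<alpha> \<kappa> z * (weight' \<alpha> \<kappa> z * E n V z * grad_sq z + E n grad_sq z)) z"
      by (intro wirtinger_smooth_cong[OF open_dom smooth_on_wirtinger[OF open_dom smP'] EP z])
    then show ?thesis
      using d[OF z]
      by (simp add: wirtinger_mult wirtinger_add differentiable_mult differentiable_add wirtinger_weight[OF z]
        wirtinger_weight'[OF z] h U_def[symmetric] G_def e_def w_def algebra_simps power2_eq_square)
  qed
  have 1: "(\<Sum>m\<in>UNIV. \<Sum>n\<in>UNIV. B m n z * (D m V z * E n V z)) = of_real (Psi f z)"
    using grad_sq_real[OF z] by (simp add: grad_sq_eq mult.assoc)
  have 2: "(\<Sum>m\<in>UNIV. \<Sum>n\<in>UNIV. B m n z * U m n z) = - of_real (scal_curv f z)"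
    using lap_V_real[OF z] by (simp add: lap_V_def)
  define C where "C = (\<Sum>m\<in>UNIV. X m z * D m grad_sq z)"
  have 3: "(\<Sum>m\<in>UNIV. \<Sum>n\<in>UNIV. B m n z * (E n V z * D m grad_sq z)) = C"
    unfolding C_def X_def sum_distrib_right by (simp add: mult.assoc)
  \<comment> \<open>\<open>grad_sq\<close> is real, so the second cross term is the conjugate of the
    first, and together they give \<open>2 * h * Re C\<close>.\<close>
  have 4: "(\<Sum>m\<in>UNIV. \<Sum>n\<in>UNIV. B m n z * (D m V z * E n grad_sq z)) = cnj C"
  proof -
    have "E n grad_sq z = cnj (D n grad_sq z)" for n
      using wirtinger_cnj_cong[OF smooth_on_grad_sq z, of grad_sq "- \<i>"] by (simp add: grad_sq_real)
    then have "cnj C = (\<Sum>n\<in>UNIV. Y n z * E n grad_sq z)"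
      by (simp add: C_def X_cnj[OF z])
    also have "\<dots> = (\<Sum>m\<in>UNIV. \<Sum>n\<in>UNIV. B m n z * (D m V z * E n grad_sq z))"
      unfolding Y_def sum_distrib_right by (subst sum.swap) (simp add: mult.assoc)
    finally show ?thesis ..
  qed
  define R where "R = (\<Sum>m\<in>UNIV. \<Sum>n\<in>UNIV. B m n z * D m (E n grad_sq) z)"
  have "(\<Sum>m\<in>UNIV. \<Sum>n\<in>UNIV. B m n z * D m (E n (real_to_complex_fun (P_fun \<alpha> \<kappa> f))) z) =
    G * (((of_real h)\<^sup>2 + e) * grad_sq z * (\<Sum>m\<in>UNIV. \<Sum>n\<in>UNIV. B m n z * (D m V z * E n V z))
      + of_real h * grad_sq z * (\<Sum>m\<in>UNIV. \<Sum>n\<in>UNIV. B m n z * U m n z)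
      + of_real h * (\<Sum>m\<in>UNIV. \<Sum>n\<in>UNIV. B m n z * (D m V z * E n grad_sq z))
      + of_real h * (\<Sum>m\<in>UNIV. \<Sum>n\<in>UNIV. B m n z * (E n V z * D m grad_sq z)) + R)"
    unfolding DEP R_def sum_distrib_left sum.distrib[symmetric]
    by (intro sum.cong refl) (simp only: algebra_simps)
  also have "\<dots> = G * (of_real ((h\<^sup>2 + \<alpha>\<^sup>2 * \<kappa> * w) * (Psi f z)\<^sup>2 - h * scal_curv f z * Psi f z)
      + of_real h * (cnj C + C) + R)"
    unfolding 1 2 3 4 grad_sq_real[OF z] e_def by (simp add: algebra_simps power2_eq_square)
  finally have "square_op f (P_fun \<alpha> \<kappa> f) z =
    Re (G * (of_real ((h\<^sup>2 + \<alpha>\<^sup>2 * \<kappa> * w) * (Psi f z)\<^sup>2 - h * scal_curv f z * Psi f z)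
      + of_real h * (cnj C + C) + R))"
    by (simp only: square_op_eq)
  also have "G = of_real (exp (\<kappa> * w) * sqrt (det_metric f z))"
    unfolding G_def w_def by (rule weight_real[OF z])
  also have "Re (of_real a * (of_real b + of_real h * (cnj C + C) + R)) = a * (b + 2 * h * Re C + Re R)" for a b
    by simp
  finally show ?thesis
    unfolding C_def R_def .
qed

end

section \<open>Completing the two squares\<close>

theorem lemma5p1:
  fixes \<Omega> :: "(complex^'n::finite) set"
    and f :: "complex^'n \<Rightarrow> real"
    and \<alpha> \<kappa> :: real
  assumes "domain_set \<Omega>"
    and "smooth_on f \<Omega>"
    and "\<forall>z\<in>\<Omega>. pos_def_hermitian (complex_hessian f z)"
  shows "\<forall>z\<in>\<Omega>. Psi f z \<noteq> 0 \<longrightarrow>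
    square_op f (P_fun \<alpha> \<kappa> f) z / P_fun \<alpha> \<kappa> f z \<ge>
      mixed_hessian_norm_sq f (log_det_metric f) z / (2 * Psi f z)
      + \<alpha>\<^sup>2 * \<kappa> * (1 - 2 * \<kappa> * det_metric f z powr \<alpha>) * det_metric f z powr \<alpha> * Psi f z
      - 2 * cmod (grad_inner f (scal_curv f) (log_det_metric f) z) / Psi f z
      - (\<alpha> * \<kappa> * det_metric f z powr \<alpha> + 1 / 2) * scal_curv f z"
proof (intro ballI impI)
  fix z assume z: "z \<in> \<Omega>" and nz: "Psi f z \<noteq> 0"
  interpret kaehler_potential \<Omega> f
    using assms by unfold_locales (auto simp: domain_set_def)
  define w where "w = det_metric f z powr \<alpha>"
  define a where "a = \<alpha> * \<kappa> * w"
  define h where "h = a + 1 / 2"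
  define p where "p = Psi f z"
  define s where "s = scal_curv f z"
  define g where "g = grad_inner f (scal_curv f) (log_det_metric f) z"
  define t where "t = Re (\<Sum>i\<in>UNIV. \<Sum>j\<in>UNIV. \<Sum>k\<in>UNIV. \<Sum>l\<in>UNIV. B i j z * B k l z * T i k z * cnj (T j l z))"
  define u where "u = mixed_hessian_norm_sq f (log_det_metric f) z"
  define \<tau> where "\<tau> = Re (\<Sum>i\<in>UNIV. \<Sum>k\<in>UNIV. X i z * X k z * T i k z)"
  define \<rho> where "\<rho> = Re (\<Sum>i\<in>UNIV. \<Sum>k\<in>UNIV. X i z * Y k z * U i k z)"
  have p: "p > 0"
    using Psi_nonneg[OF z] nz by (simp add: p_def)
  have X: "(\<Sum>j\<in>UNIV. B i j z * cnj (D j V z)) = X i z" for i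
    by (simp add: X_def E_V[OF z])
  have N: "(\<Sum>i\<in>UNIV. \<Sum>j\<in>UNIV. B i j z * D i V z * cnj (D j V z)) = of_real p"
    using grad_sq_real[OF z] by (simp add: grad_sq_eq E_V[OF z] p_def)
  have N': "(\<Sum>i\<in>UNIV. \<Sum>j\<in>UNIV. B j i z * E i V z * cnj (E j V z)) = of_real p"
    unfolding N[symmetric] by (subst sum.swap) (simp add: E_V[OF z] mult_ac)
  have sq: "Re (of_real p * of_real p) = p\<^sup>2"
    by (simp add: power2_eq_square)
  \<comment> \<open>Both indices of \<open>T\<close> are holomorphic, so both slots use
    \<open>B\<close> and the derivative \<open>D V\<close>. The factor \<open>h\<close> is chosen to
    match the coefficient \<open>2 * h\<close> of \<tau> in the Laplacian.\<close>
  have 1: "0 \<le> t + 2 * h * \<tau> + h\<^sup>2 * p\<^sup>2"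
    using hermitian_psd_tensor_shift_nonneg[OF B_psd[OF z] B_psd[OF z],
        of "\<lambda>i k. T i k z" h "\<lambda>i. D i V z" "\<lambda>i. D i V z"]
    unfolding X N sq t_def \<tau>_def .
  \<comment> \<open>The second index of \<open>U\<close> is antiholomorphic, hence the transposed
    metric and \<open>E V\<close> in the second slot. The factor is \<open>2 * a\<close> because
    only half of this inequality is used: half of \<open>4 * a * \<rho>\<close> is the available
    \<open>2 * a * \<rho>\<close>, and \<open>u / 2\<close> survives.\<close>
  have 2: "0 \<le> u + 2 * (2 * a) * \<rho> + (2 * a)\<^sup>2 * p\<^sup>2"
  proof -
    have "(\<Sum>i\<in>UNIV. \<Sum>j\<in>UNIV. \<Sum>k\<in>UNIV. \<Sum>l\<in>UNIV. B i j z * B l k z * U i k z * cnj (U j l z)) =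
      (\<Sum>i\<in>UNIV. \<Sum>j\<in>UNIV. \<Sum>k\<in>UNIV. \<Sum>l\<in>UNIV. B i j z * B k l z * U i l z * U k j z)"
      unfolding U_hermitian[OF z] by (intro sum.cong refl sum.swap)
    moreover have "(\<Sum>l\<in>UNIV. B l k z * cnj (E l V z)) = Y k z" for k
      by (simp add: Y_def E_V[OF z])
    ultimately show ?thesis
      using hermitian_psd_tensor_shift_nonneg[OF B_psd[OF z] hermitian_psd_transpose[OF B_psd[OF z]],
        of "\<lambda>i k. U i k z" "2 * a" "\<lambda>i. D i V z" "\<lambda>i. E i V z"]
      unfolding X N N' sq u_def \<rho>_def mixed_hessian_norm_sq_eq by simp
  qed
  \<comment> \<open>\<tau> and \<rho> are the covariant Hessians \<open>T\<close> and
    \<open>U\<close> evaluated on the gradient of \<open>V\<close>; the derivative of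
    \<open>Psi\<close> along the gradient is made up of just these two.\<close>
  have 3: "Re (\<Sum>m\<in>UNIV. X m z * D m grad_sq z) = \<tau> + \<rho>"
  proof -
    have "(\<Sum>m\<in>UNIV. X m z * D m grad_sq z) =
      (\<Sum>m\<in>UNIV. \<Sum>q\<in>UNIV. X m z * X q z * T q m z) + (\<Sum>m\<in>UNIV. \<Sum>q\<in>UNIV. X m z * Y q z * U m q z)"
      using D_grad_sq[OF z]
      by (simp add: sum_distrib_left distrib_left sum.distrib mult.assoc)
    also have "(\<Sum>m\<in>UNIV. \<Sum>q\<in>UNIV. X m z * X q z * T q m z) = (\<Sum>i\<in>UNIV. \<Sum>k\<in>UNIV. X i z * X k z * T i k z)"
      by (subst sum.swap) (simp add: mult.commute)
    finally show ?thesis by (simp only: \<tau>_def \<rho>_def plus_complex.sel)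
  qed
  have 4: "Re (\<Sum>m\<in>UNIV. \<Sum>n\<in>UNIV. B m n z * D m (E n grad_sq) z) = t + u - 2 * Re g - \<rho>"
  proof -
    have "(\<Sum>p\<in>UNIV. X p z * D p lap_V z) = - cnj g" "(\<Sum>j\<in>UNIV. Y j z * E j lap_V z) = - g"
      unfolding g_def using grad_inner_scal_curv_cnj[OF z] grad_inner_scal_curv[OF z] by simp_all
    then show ?thesis
      unfolding bochner[OF z] t_def u_def \<rho>_def mixed_hessian_norm_sq_eq
      by (simp only: plus_complex.sel minus_complex.sel uminus_complex.sel cnj.sel)
  qed
  define c where "c = exp (\<kappa> * w) * sqrt (det_metric f z)"
  have c: "c > 0" using det_pos[OF z] by (simp add: c_def)
  have "square_op f (P_fun \<alpha> \<kappa> f) z = c * ((h\<^sup>2 + \<alpha>\<^sup>2 * \<kappa> * w) * p\<^sup>2 - h * s * p + 2 * h * (\<tau> + \<rho>)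
      + (t + u - 2 * Re g - \<rho>))"
    using square_P_fun[OF z, of \<alpha> \<kappa>] unfolding 3 4
    by (simp only: c_def h_def a_def w_def p_def s_def)
  moreover have "P_fun \<alpha> \<kappa> f z = c * p"
    by (simp add: P_fun_def c_def w_def p_def)
  ultimately have "square_op f (P_fun \<alpha> \<kappa> f) z / P_fun \<alpha> \<kappa> f z =
      ((h\<^sup>2 + \<alpha>\<^sup>2 * \<kappa> * w) * p\<^sup>2 - h * s * p + 2 * h * (\<tau> + \<rho>) + (t + u - 2 * Re g - \<rho>)) / p"
    using c by simp
  also have "\<dots> \<ge> (u / 2 + \<alpha>\<^sup>2 * \<kappa> * (1 - 2 * \<kappa> * w) * w * p\<^sup>2 - 2 * cmod g - h * s * p) / p"
  proof (intro divide_right_mono)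
    have "Re g \<le> cmod g" by (rule complex_Re_le_cmod)
    \<comment> \<open>Sets aside the amount \<open>2 * a\<^sup>2 * p\<^sup>2\<close> that half of
      the second square consumes.\<close>
    moreover have "\<alpha>\<^sup>2 * \<kappa> * w * p\<^sup>2 = \<alpha>\<^sup>2 * \<kappa> * (1 - 2 * \<kappa> * w) * w * p\<^sup>2 + 2 * a\<^sup>2 * p\<^sup>2"
      by (simp add: a_def algebra_simps power2_eq_square)
    \<comment> \<open>The summand 1/2 of \<open>h\<close> cancels the Ricci term
      \<open>- \<rho>\<close>.\<close>
    moreover have "2 * h * (\<tau> + \<rho>) - \<rho> = 2 * h * \<tau> + 2 * a * \<rho>"
      by (simp add: h_def algebra_simps)
    ultimately show "u / 2 + \<alpha>\<^sup>2 * \<kappa> * (1 - 2 * \<kappa> * w) * w * p\<^sup>2 - 2 * cmod g - h * s * p \<le>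
      (h\<^sup>2 + \<alpha>\<^sup>2 * \<kappa> * w) * p\<^sup>2 - h * s * p + 2 * h * (\<tau> + \<rho>) + (t + u - 2 * Re g - \<rho>)"
      using 1 2 by (simp add: distrib_right power_mult_distrib)
  qed (use p in simp)
  also have "(u / 2 + \<alpha>\<^sup>2 * \<kappa> * (1 - 2 * \<kappa> * w) * w * p\<^sup>2 - 2 * cmod g - h * s * p) / p =
      u / (2 * p) + \<alpha>\<^sup>2 * \<kappa> * (1 - 2 * \<kappa> * w) * w * p - 2 * cmod g / p - h * s"
    using p by (simp add: diff_divide_distrib add_divide_distrib power2_eq_square)
  finally show "square_op f (P_fun \<alpha> \<kappa> f) z / P_fun \<alpha> \<kappa> f z \<ge>
      mixed_hessian_norm_sq f (log_det_metric f) z / (2 * Psi f z)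
      + \<alpha>\<^sup>2 * \<kappa> * (1 - 2 * \<kappa> * det_metric f z powr \<alpha>) * det_metric f z powr \<alpha> * Psi f z
      - 2 * cmod (grad_inner f (scal_curv f) (log_det_metric f) z) / Psi f z
      - (\<alpha> * \<kappa> * det_metric f z powr \<alpha> + 1 / 2) * scal_curv f z"
    unfolding u_def p_def g_def s_def h_def a_def w_def .
qed

end
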